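(* Let $n\ge1$. The Poincaré polynomial of $\widetilde{\mathcal J}^+(S^{2n})$ is $$P_t(\widetilde{\mathcal J}^+(S^{2n}))=(1+t^2)(1+t^4)\cdots(1+t^{2n}).$$
   Context: Let $J_0$ be the $(2n+2)\times(2n+2)$ block diagonal matrix with $n+1$ diagonal blocks $\begin{pmatrix}0&-1\\1&0\end{pmatrix}$. Then $\widetilde{\mathcal J}^+(S^{2n})=\{GJ_0G^t : G\in SO(2n+2)\}$, with the topology induced from the space of real $(2n+2)\times(2n+2)$ matrices; it is one of the two connected components of $\{A\in GL(2n+2,\mathbb R): A^2=-I,\ A^t=-A\}$, and is the twistor space of oriented orthogonal almost complex structures on $S^{2n}$. The Poincaré polynomial of a space $M$ is $P_t(M)=\sum_i b_i(M)t^i$ with $b_i(M)$ the $i$-th Betti number. *)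

theory Defs
  imports
    "HOL-Homology.Homology"
    "HOL-Computational_Algebra.Formal_Power_Series"
    "HOL-Library.Extended_Nat"
    "Jordan_Normal_Form.Determinant"
begin

text \<open>
  \<open>G\<close> is meant to be an abelian group, written multiplicatively as in HOL-Algebra, so that
  \<open>\<Otimes>x\<in>S. x [^] c x\<close> is the integer linear combination of \<open>S\<close> with coefficients \<open>c\<close>.
\<close>

definition int_independent :: "('a, 'b) monoid_scheme \<Rightarrow> 'a set \<Rightarrow> bool" where
  "int_independent G S \<longleftrightarrow> finite S \<and> S \<subseteq> carrier G \<and>
     (\<forall>c :: 'a \<Rightarrow> int. finprod G (\<lambda>x. x [^]\<^bsub>G\<^esub> c x) S = \<one>\<^bsub>G\<^esub> \<longrightarrow> (\<forall>x\<in>S. c x = 0))"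

definition abelian_group_rank :: "('a, 'b) monoid_scheme \<Rightarrow> enat" where
  "abelian_group_rank G = (SUP S\<in>{S. int_independent G S}. enat (card S))"

definition betti_number :: "nat \<Rightarrow> 'a topology \<Rightarrow> enat" where
  "betti_number i X = abelian_group_rank (homology_group (int i) X)"

text \<open>
  The sum \<open>\<Sum>i. b\<^sub>i(X) t\<^sup>i\<close> is a formal power series with coefficients in \<open>\<nat> \<union> {\<infinity>}\<close>, so that it is
  defined for every space. An equation with a polynomial whose coefficients are finite includes the
  finiteness of every Betti number and the vanishing of all but finitely many of them.
\<close>

definition poincare_polynomial :: "'a topology \<Rightarrow> enat fps" where
  "poincare_polynomial X = Abs_fps (\<lambda>i. betti_number i X)"

text \<open>
  The type of matrices contains all sizes at once and has no topology. The matrices of size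
  \<open>m \<times> n\<close> get the topology of \<open>\<real>\<^sup>m\<^sup>n\<close> through their entries; the restriction is needed because
  \<open>A $$ (i, j)\<close> is an unspecified value for \<open>(i, j)\<close> out of bounds.
\<close>

definition matrix_topology :: "nat \<Rightarrow> nat \<Rightarrow> real mat topology" where
  "matrix_topology m n =
     pullback_topology (carrier_mat m n)
       (\<lambda>A. restrict (\<lambda>ij. A $$ ij) ({..<m} \<times> {..<n}))
       (product_topology (\<lambda>_. euclideanreal) ({..<m} \<times> {..<n}))"

definition SO_mat :: "nat \<Rightarrow> real mat set" where
  "SO_mat N = {G \<in> carrier_mat N N. G * transpose_mat G = 1\<^sub>m N \<and> Determinant.det G = 1}"

definition J0 :: "nat \<Rightarrow> real mat" where
  "J0 n = diag_block_mat (replicate (n + 1) (mat_of_rows_list 2 [[0, -1], [1, 0]]))"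

definition twistor_space :: "nat \<Rightarrow> real mat topology" where
  "twistor_space n =
     subtopology (matrix_topology (2 * n + 2) (2 * n + 2))
       {G * J0 n * transpose_mat G | G. G \<in> SO_mat (2 * n + 2)}"

end

theory Submission
  imports Defs
begin

text \<open>
  The map \<open>A \<mapsto> A e\<^sub>0\<close> fibres the twistor space \<open>X\<^sub>n\<^sub>+\<^sub>1\<close> over the sphere of dimension \<open>2n + 2\<close>, with fibre
  \<open>X\<^sub>n\<close>. Let \<open>U\<close> be the part over the complement of \<open>- e\<^sub>1\<close>. A rotation depending continuously on
  the base point trivialises \<open>U\<close> as \<open>\<real>\<^sup>2\<^sup>n\<^sup>+\<^sup>2 \<times> X\<^sub>n\<close>, so \<open>U\<close> has the homology of \<open>X\<^sub>n\<close>. By excision, and a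
  conjugation that exchanges \<open>e\<^sub>1\<close> and \<open>- e\<^sub>1\<close>, the homology of \<open>(X\<^sub>n\<^sub>+\<^sub>1, U)\<close> is that of
  \<open>\<real>\<^sup>2\<^sup>n\<^sup>+\<^sup>2 \<times> X\<^sub>n\<close> relative to \<open>(\<real>\<^sup>2\<^sup>n\<^sup>+\<^sup>2 - 0) \<times> X\<^sub>n\<close>, that is, the homology of \<open>X\<^sub>n\<close> shifted by
  \<open>2n + 2\<close>. By induction all odd homology groups vanish, so the long exact sequence of the pair
  splits into short ones and ranks add.
\<close>

unbundle no vec_syntax
unbundle no inner_syntax

section \<open>Ranks of abelian groups\<close>

text \<open>A matrix of the space is skew and orthogonal, so A e_0 is a unit vector orthogonal to
  e_0; this is why the base is a sphere. The matrices over e_1 split as a rotation of the plane of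
  e_0 and e_1 plus a structure on the complement. The difficulty is that this structure must lie in
  the same component, not merely be skew and orthogonal. For this reason all motions are products of
  two reflections: equal determinants put the product in SO, and a correction by such products
  commuting with \<open>J0\<close> replaces any discussion of orientations. The induction survives
  because the base has even dimension, so that the shift by 2n + 2 preserves parity. Vanishing in
  odd degrees kills every connecting map, and ranks are additive on short exact sequences, so no
  extension problem has to be solved. On coefficients each step is multiplication by 1 + t^(2n+2),
  and the start n = 0 is a single point.\<close>

definition indep_family :: "('a, 'b) monoid_scheme \<Rightarrow> ('i \<Rightarrow> 'a) \<Rightarrow> 'i set \<Rightarrow> bool" where
  "indep_family G f I \<longleftrightarrow> finite I \<and> f \<in> I \<rightarrow> carrier G \<and>
     (\<forall>c :: 'i \<Rightarrow> int. finprod G (\<lambda>i. f i [^]\<^bsub>G\<^esub> c i) I = \<one>\<^bsub>G\<^esub> \<longrightarrow> (\<forall>i\<in>I. c i = 0))"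

lemma int_independent_iff_indep_family: "int_independent G S \<longleftrightarrow> indep_family G (\<lambda>x. x) S"
  by (auto simp: int_independent_def indep_family_def Pi_def)

lemma indep_familyD:
  assumes "indep_family G f I" "finprod G (\<lambda>i. f i [^]\<^bsub>G\<^esub> (c i :: int)) I = \<one>\<^bsub>G\<^esub>"
  shows "\<forall>i\<in>I. c i = 0"
  using assms unfolding indep_family_def by blast

lemma int_independentD:
  assumes "int_independent G S" "finprod G (\<lambda>i. i [^]\<^bsub>G\<^esub> (c i :: int)) S = \<one>\<^bsub>G\<^esub>"
  shows "\<forall>i\<in>S. c i = 0"
  using assms unfolding int_independent_def by blast

lemma int_independent_finite: "int_independent G S \<Longrightarrow> finite S"
  and int_independent_carrier: "int_independent G S \<Longrightarrow> S \<subseteq> carrier G"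
  unfolding int_independent_def by blast+

lemma indep_family_finite: "indep_family G f I \<Longrightarrow> finite I"
  and indep_family_carrier: "indep_family G f I \<Longrightarrow> f \<in> I \<rightarrow> carrier G"
  unfolding indep_family_def by blast+

lemma (in comm_group) finprod_int_pow_mult:
  assumes "f \<in> I \<rightarrow> carrier G"
  shows "finprod G (\<lambda>i. f i [^] (c i + d i :: int)) I
    = finprod G (\<lambda>i. f i [^] c i) I \<otimes> finprod G (\<lambda>i. f i [^] d i) I"
proof -
  have "finprod G (\<lambda>i. f i [^] (c i + d i)) I = finprod G (\<lambda>i. f i [^] c i \<otimes> f i [^] d i) I"
    using assms by (intro finprod_cong') (auto simp: int_pow_mult Pi_def)
  also have "\<dots> = finprod G (\<lambda>i. f i [^] c i) I \<otimes> finprod G (\<lambda>i. f i [^] d i) I"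
    using assms by (intro finprod_multf) (auto simp: Pi_def)
  finally show ?thesis .
qed

lemma (in comm_group) finprod_int_pow_smult:
  assumes "finite I" "f \<in> I \<rightarrow> carrier G"
  shows "finprod G (\<lambda>i. f i [^] (c i * m :: int)) I = finprod G (\<lambda>i. f i [^] c i) I [^] m"
  using assms
proof (induction I rule: finite_induct)
  case (insert x F)
  have "finprod G (\<lambda>i. f i [^] c i) F \<in> carrier G"
    using insert.prems by (intro finprod_closed) (auto simp: Pi_def)
  moreover have "finprod G (\<lambda>i. f i [^] (c i * m)) (insert x F)
     = f x [^] (c x * m) \<otimes> finprod G (\<lambda>i. f i [^] (c i * m)) F"
    using insert by (subst finprod_insert) (auto simp: Pi_def)
  moreover have "finprod G (\<lambda>i. f i [^] c i) (insert x F)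
     = f x [^] c x \<otimes> finprod G (\<lambda>i. f i [^] c i) F"
    using insert by (subst finprod_insert) (auto simp: Pi_def)
  ultimately show ?case
    using insert by (simp add: int_pow_distrib int_pow_pow Pi_def)
qed auto

lemma (in comm_group) finprod_int_pow_swap:
  assumes "finite K" "finite I" "f \<in> I \<rightarrow> carrier G"
  shows "finprod G (\<lambda>k. finprod G (\<lambda>i. f i [^] (c k i)) I [^] (d k :: int)) K
    = finprod G (\<lambda>i. f i [^] (\<Sum>k\<in>K. c k i * d k)) I"
  using assms(1)
proof (induction K rule: finite_induct)
  case empty
  then show ?case using finprod_one_eqI[of I] by simp
next
  case (insert k K)
  have cl: "finprod G (\<lambda>i. f i [^] (c k i)) I \<in> carrier G" for k
    using assms by (intro finprod_closed) (auto simp: Pi_def)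
  have "finprod G (\<lambda>k. finprod G (\<lambda>i. f i [^] (c k i)) I [^] (d k :: int)) (insert k K)
     = finprod G (\<lambda>i. f i [^] (c k i)) I [^] d k \<otimes> finprod G (\<lambda>i. f i [^] (\<Sum>k\<in>K. c k i * d k)) I"
    using insert cl by (subst finprod_insert) auto
  also have "\<dots> = finprod G (\<lambda>i. f i [^] (c k i * d k + (\<Sum>k\<in>K. c k i * d k))) I"
    using assms by (subst finprod_int_pow_mult) (auto simp: finprod_int_pow_smult)
  finally show ?case using insert by simp
qed

lemma hom_finprod:
  assumes "comm_group G" "comm_group H" "h \<in> hom G H" "f \<in> I \<rightarrow> carrier G"
  shows "h (finprod G f I) = finprod H (\<lambda>i. h (f i)) I"
proof -
  interpret G: comm_group G by fact
  interpret H: comm_group H by fact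
  have h1: "h \<one>\<^bsub>G\<^esub> = \<one>\<^bsub>H\<^esub>"
    using assms(3) by (simp add: hom_one)
  show ?thesis
  proof (cases "finite I")
    case True
    then show ?thesis using assms(4)
    proof (induction I rule: finite_induct)
      case empty
      then show ?case using h1 by simp
    next
      case (insert x F)
      then have "f \<in> F \<rightarrow> carrier G" "f x \<in> carrier G" by auto
      moreover have "(\<lambda>i. h (f i)) \<in> F \<rightarrow> carrier H" "h (f x) \<in> carrier H"
        using assms(3) calculation by (auto simp: hom_def Pi_def)
      ultimately show ?case
        using insert assms(3) by (simp add: hom_mult G.finprod_closed)
    qed
  qed (use h1 in auto)
qed

lemma hom_finprod_int_pow:
  assumes "comm_group G" "comm_group H" "h \<in> hom G H" "f \<in> I \<rightarrow> carrier G"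
  shows "h (finprod G (\<lambda>i. f i [^]\<^bsub>G\<^esub> (c i :: int)) I) = finprod H (\<lambda>i. h (f i) [^]\<^bsub>H\<^esub> c i) I"
proof -
  interpret G: comm_group G by fact
  interpret H: comm_group H by fact
  have "h (finprod G (\<lambda>i. f i [^]\<^bsub>G\<^esub> c i) I) = finprod H (\<lambda>i. h (f i [^]\<^bsub>G\<^esub> c i)) I"
    using assms by (intro hom_finprod) (auto simp: Pi_def)
  also have "\<dots> = finprod H (\<lambda>i. h (f i) [^]\<^bsub>H\<^esub> c i) I"
    using assms by (intro H.finprod_cong')
      (auto simp: Pi_def hom_int_pow G.is_group H.is_group hom_in_carrier)
  finally show ?thesis .
qed

lemma indep_family_subset:
  assumes "comm_group G" "indep_family G f I" "J \<subseteq> I"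
  shows "indep_family G f J"
  unfolding indep_family_def
proof (intro conjI allI impI)
  interpret G: comm_group G by fact
  show "finite J" "f \<in> J \<rightarrow> carrier G"

    using indep_family_finite[OF assms(2)] indep_family_carrier[OF assms(2)] assms(3) finite_subset
    by auto
  fix c :: "_ \<Rightarrow> int" assume *: "finprod G (\<lambda>i. f i [^]\<^bsub>G\<^esub> c i) J = \<one>\<^bsub>G\<^esub>"
  have "finprod G (\<lambda>i. f i [^]\<^bsub>G\<^esub> (if i \<in> J then c i else 0)) I
      = finprod G (\<lambda>i. f i [^]\<^bsub>G\<^esub> c i) J"
    using assms by (intro G.finprod_mono_neutral_cong_right) (use indep_family_finite[OF assms(2)] indep_family_carrier[OF assms(2)] in \<open>auto simp: Pi_def\<close>)
  with * have "\<forall>i\<in>I. (if i \<in> J then c i else 0) = 0"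
    by (intro indep_familyD[OF assms(2)]) simp
  then show "\<forall>i\<in>J. c i = 0" using assms(3) by (auto split: if_splits)
qed

lemma indep_family_inj_on:
  assumes "comm_group G" "indep_family G f I"
  shows "inj_on f I"
proof (rule inj_onI, rule ccontr)
  interpret G: comm_group G by fact
  fix x y assume xy: "x \<in> I" "y \<in> I" "f x = f y" "x \<noteq> y"
  \<comment> \<open>Equal values would give the nontrivial relation f x - f y = 0, in additive
    terms.\<close>
  define c :: "_ \<Rightarrow> int" where "c = (\<lambda>i. if i = x then 1 else if i = y then -1 else 0)"
  have fx: "f x \<in> carrier G" "f y \<in> carrier G" using indep_family_carrier[OF assms(2)] xy by auto
  have "indep_family G f {x, y}"
    by (rule indep_family_subset[OF assms]) (use xy in auto)
  moreover have "finprod G (\<lambda>i. f i [^]\<^bsub>G\<^esub> c i) {x, y} = \<one>\<^bsub>G\<^esub>"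
    using xy fx by (simp add: c_def G.int_pow_neg)
  ultimately have "\<forall>i\<in>{x, y}. c i = 0" by (rule indep_familyD)
  then have "c x = 0" by simp
  then show False by (simp add: c_def)
qed

lemma indep_family_reindex:
  assumes "comm_group G" "inj_on h I"
  shows "indep_family G f (h ` I) \<longleftrightarrow> indep_family G (\<lambda>i. f (h i)) I"
proof -
  interpret G: comm_group G by fact
  have 1: "finprod G (\<lambda>i. f i [^]\<^bsub>G\<^esub> (c i :: int)) (h ` I) = finprod G (\<lambda>i. f (h i) [^]\<^bsub>G\<^esub> c (h i)) I"
    if "f \<in> h ` I \<rightarrow> carrier G" for c
    using that assms by (subst G.finprod_reindex) (auto simp: Pi_def)
  have 2: "finprod G (\<lambda>i. f (h i) [^]\<^bsub>G\<^esub> (c i :: int)) I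
      = finprod G (\<lambda>i. f i [^]\<^bsub>G\<^esub> (c (the_inv_into I h i) :: int)) (h ` I)"
    if "f \<in> h ` I \<rightarrow> carrier G" for c
    unfolding 1[OF that] using that assms
    by (intro G.finprod_cong') (auto simp: Pi_def the_inv_into_f_f)
  show ?thesis
  proof
    assume L: "indep_family G f (h ` I)"
    then have f: "f \<in> h ` I \<rightarrow> carrier G" by (rule indep_family_carrier)
    show "indep_family G (\<lambda>i. f (h i)) I"
      unfolding indep_family_def
    proof (intro conjI allI impI)
      show "finite I" "(\<lambda>i. f (h i)) \<in> I \<rightarrow> carrier G"
        using indep_family_finite[OF L] f assms by (auto simp: finite_image_iff)
      fix c :: "_ \<Rightarrow> int" assume "finprod G (\<lambda>i. f (h i) [^]\<^bsub>G\<^esub> c i) I = \<one>\<^bsub>G\<^esub>"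
      then have "\<forall>i\<in>h ` I. c (the_inv_into I h i) = 0"
        unfolding 2[OF f] by (rule indep_familyD[OF L])
      then show "\<forall>i\<in>I. c i = 0" using assms by (simp add: the_inv_into_f_f)
    qed
  next
    assume R: "indep_family G (\<lambda>i. f (h i)) I"
    show "indep_family G f (h ` I)"
      unfolding indep_family_def
    proof (intro conjI allI impI)
      show "finite (h ` I)" and f: "f \<in> h ` I \<rightarrow> carrier G"
        using indep_family_finite[OF R] indep_family_carrier[OF R] by auto
      fix c :: "_ \<Rightarrow> int" assume "finprod G (\<lambda>i. f i [^]\<^bsub>G\<^esub> c i) (h ` I) = \<one>\<^bsub>G\<^esub>"
      then have "\<forall>i\<in>I. c (h i) = 0"
        unfolding 1[OF f] by (rule indep_familyD[OF R])
      then show "\<forall>i\<in>h ` I. c i = 0" by simp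
    qed
  qed
qed

text \<open>Exactness arguments produce families indexed by a disjoint sum or by elements of another
  group, whereas the rank is defined through sets. An independent family is injective, so its image
  is an independent set of the same size.\<close>

lemma indep_family_card_le_rank:
  assumes "comm_group G" "indep_family G f I"
  shows "enat (card I) \<le> abelian_group_rank G"
proof -
  have inj: "inj_on f I" by (rule indep_family_inj_on[OF assms])
  have "int_independent G (f ` I)"
    unfolding int_independent_iff_indep_family using assms inj by (subst indep_family_reindex) auto
  then have "enat (card (f ` I)) \<le> abelian_group_rank G"
    unfolding abelian_group_rank_def by (intro SUP_upper) auto
  then show ?thesis using inj by (simp add: card_image)
qed

lemma abelian_group_rank_le:
  assumes "\<And>S. int_independent G S \<Longrightarrow> enat (card S) \<le> r"
  shows "abelian_group_rank G \<le> r"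
  unfolding abelian_group_rank_def using assms by (intro SUP_least) auto

text \<open>Independent sets are finite, so an infinite rank is a supremum that no set attains;
  witnesses are available only for finite lower bounds.\<close>

lemma abelian_group_rank_witness:
  assumes "enat k \<le> abelian_group_rank G"
  obtains S where "int_independent G S" "k \<le> card S"
proof (cases k)
  case 0
  have "int_independent G {}" by (simp add: int_independent_def)
  with 0 show ?thesis using that by blast
next
  case (Suc m)
  \<comment> \<open>A strict bound is needed, because only values strictly below a supremum are sure
    to be exceeded by a member.\<close>
  then have "enat m < abelian_group_rank G" using assms by (simp add: Suc_ile_eq)
  then obtain S where "int_independent G S" "enat m < enat (card S)"
    unfolding abelian_group_rank_def less_SUP_iff by auto
  then show ?thesis using that Suc by auto
qed

text \<open>Allows a lower bound by a sum of two ranks to be proved on finite approximations; if one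
  summand is infinite, these force z to be infinite as well.\<close>

lemma enat_add_leI:
  fixes x y z :: enat
  assumes "\<And>k l. enat k \<le> x \<Longrightarrow> enat l \<le> y \<Longrightarrow> enat (k + l) \<le> z"
  shows "x + y \<le> z"
proof -
  have inf: "z = \<infinity>" if "\<And>k. enat k \<le> z"
    using that by (metis Suc_n_not_le_n enat.exhaust enat_ord_simps(1))
  consider "x = \<infinity>" | "y = \<infinity>" | a b where "x = enat a" "y = enat b"
    by (metis enat.exhaust)
  then show ?thesis
  proof cases
    case 1
    then have "enat k \<le> z" for k
      using assms[of k 0] by (simp add: zero_enat_def[symmetric])
    then show ?thesis using inf by simp
  next
    case 2
    then have "enat k \<le> z" for k
      using assms[of 0 k] by (simp add: zero_enat_def[symmetric])
    then show ?thesis using inf by simp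
  next
    case 3
    then show ?thesis using assms[of a b] by simp
  qed
qed

text \<open>An independent set of C lifted through f, together with the image of one of A, is
  independent: f kills the part from A, so the coefficients on the lifts vanish, and injectivity of
  g then disposes of the others.\<close>

lemma abelian_group_rank_exact_ge:
  assumes A: "comm_group A" and B: "comm_group B" and C: "comm_group C"
    and g: "g \<in> hom A B" "inj_on g (carrier A)"
    and f: "f \<in> hom B C" "f ` carrier B = carrier C"
    and ex: "g ` carrier A = kernel B C f"
  shows "abelian_group_rank A + abelian_group_rank C \<le> abelian_group_rank B"
proof (rule enat_add_leI)
  interpret A: comm_group A by fact
  interpret B: comm_group B by fact
  interpret C: comm_group C by fact
  fix k l assume "enat k \<le> abelian_group_rank A" "enat l \<le> abelian_group_rank C"
  note kl = this
  obtain SA where SA: "int_independent A SA" "k \<le> card SA"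
    by (rule abelian_group_rank_witness[OF kl(1)])
  obtain SC where SC: "int_independent C SC" "l \<le> card SC"
    by (rule abelian_group_rank_witness[OF kl(2)])
  note S = SA SC
  have finS: "finite SA" "finite SC" "SA \<subseteq> carrier A" "SC \<subseteq> carrier C"
    using int_independent_finite[OF S(1)] int_independent_finite[OF S(3)]
      int_independent_carrier[OF S(1)] int_independent_carrier[OF S(3)] by blast+
  have "\<forall>x\<in>SC. \<exists>y. y \<in> carrier B \<and> f y = x"
    using f finS by (metis imageE subsetD)
  then obtain s where s: "\<And>x. x \<in> SC \<Longrightarrow> s x \<in> carrier B \<and> f (s x) = x" by metis
  define h where "h = (\<lambda>z. case z of Inl a \<Rightarrow> g a | Inr c \<Rightarrow> s c)"
  have fg: "f (g a) = \<one>\<^bsub>C\<^esub>" "g a \<in> carrier B" if "a \<in> carrier A" for a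
    using ex that by (auto simp: kernel_def)
  have hB: "h \<in> SA <+> SC \<rightarrow> carrier B"
    using finS s fg by (auto simp: h_def)
  have "indep_family B h (SA <+> SC)"
    unfolding indep_family_def
  proof (intro conjI allI impI)
    show "finite (SA <+> SC)" using finS by simp
    show "h \<in> SA <+> SC \<rightarrow> carrier B" by fact
    fix c :: "_ \<Rightarrow> int" assume 1: "finprod B (\<lambda>i. h i [^]\<^bsub>B\<^esub> c i) (SA <+> SC) = \<one>\<^bsub>B\<^esub>"
    have gA: "finprod B (\<lambda>i. h i [^]\<^bsub>B\<^esub> c i) (Inl ` SA) = g (finprod A (\<lambda>i. i [^]\<^bsub>A\<^esub> c (Inl i)) SA)"
    proof -
      have "finprod B (\<lambda>i. h i [^]\<^bsub>B\<^esub> c i) (Inl ` SA) = finprod B (\<lambda>i. g i [^]\<^bsub>B\<^esub> c (Inl i)) SA"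
        using hB by (subst B.finprod_reindex) (auto simp: h_def)
      also have "\<dots> = g (finprod A (\<lambda>i. i [^]\<^bsub>A\<^esub> c (Inl i)) SA)"
        by (rule hom_finprod_int_pow[symmetric, OF A B g(1)]) (use finS in auto)
      finally show ?thesis .
    qed
    have sC: "finprod B (\<lambda>i. h i [^]\<^bsub>B\<^esub> c i) (Inr ` SC) = finprod B (\<lambda>i. s i [^]\<^bsub>B\<^esub> c (Inr i)) SC"
        using hB by (subst B.finprod_reindex) (auto simp: h_def)
    have prodA: "finprod A (\<lambda>i. i [^]\<^bsub>A\<^esub> c (Inl i)) SA \<in> carrier A"
      using finS by (intro A.finprod_closed) auto
    have prodB: "finprod B (\<lambda>i. s i [^]\<^bsub>B\<^esub> c (Inr i)) SC \<in> carrier B"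
      using s by (intro B.finprod_closed) auto
    have 2: "\<one>\<^bsub>B\<^esub> = g (finprod A (\<lambda>i. i [^]\<^bsub>A\<^esub> c (Inl i)) SA)
           \<otimes>\<^bsub>B\<^esub> finprod B (\<lambda>i. s i [^]\<^bsub>B\<^esub> c (Inr i)) SC"
      unfolding 1[symmetric] Plus_def gA[symmetric] sC[symmetric]
      by (rule B.finprod_Un_disjoint) (use finS hB in auto)
    then have "\<one>\<^bsub>C\<^esub> = f (g (finprod A (\<lambda>i. i [^]\<^bsub>A\<^esub> c (Inl i)) SA)
           \<otimes>\<^bsub>B\<^esub> finprod B (\<lambda>i. s i [^]\<^bsub>B\<^esub> c (Inr i)) SC)"
      using hom_one[OF f(1) B.is_group C.is_group] by simp
    also have "\<dots> = f (finprod B (\<lambda>i. s i [^]\<^bsub>B\<^esub> c (Inr i)) SC)"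
      using f(1) fg prodA prodB by (simp add: hom_mult hom_in_carrier)
    also have "\<dots> = finprod C (\<lambda>i. f (s i) [^]\<^bsub>C\<^esub> c (Inr i)) SC"
      by (rule hom_finprod_int_pow[OF B C f(1)]) (use s in auto)
    also have "\<dots> = finprod C (\<lambda>i. i [^]\<^bsub>C\<^esub> c (Inr i)) SC"
      using s finS by (intro C.finprod_cong') auto
    finally have cC: "\<forall>i\<in>SC. c (Inr i) = 0"
      by (intro int_independentD[OF S(3)]) simp
    then have "finprod B (\<lambda>i. s i [^]\<^bsub>B\<^esub> c (Inr i)) SC = \<one>\<^bsub>B\<^esub>"
      by (intro B.finprod_one_eqI) auto
    with 2 have "g (finprod A (\<lambda>i. i [^]\<^bsub>A\<^esub> c (Inl i)) SA) = g \<one>\<^bsub>A\<^esub>"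
      using hom_one[OF g(1) A.is_group B.is_group] fg(2)[OF prodA] by simp
    then have "finprod A (\<lambda>i. i [^]\<^bsub>A\<^esub> c (Inl i)) SA = \<one>\<^bsub>A\<^esub>"
      using g(2) prodA by (simp add: inj_on_eq_iff)
    then have "\<forall>i\<in>SA. c (Inl i) = 0"
      by (rule int_independentD[OF S(1)])
    with cC show "\<forall>i\<in>SA <+> SC. c i = 0" by auto
  qed
  then have "enat (card (SA <+> SC)) \<le> abelian_group_rank B"
    by (rule indep_family_card_le_rank[OF B])
  moreover have "k + l \<le> card (SA <+> SC)"
    using S finS by (simp add: card_Plus)
  ultimately show "enat (k + l) \<le> abelian_group_rank B"
    by (meson enat_ord_simps(1) order_trans)
qed

text \<open>
  A subset \<open>T\<close> of an independent set \<open>S\<close> that is maximal among those with independent image in \<open>C\<close>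
  has at most rank \<open>C\<close> elements, and each element of \<open>S - T\<close> has a nonzero multiple that is
  congruent to a combination of \<open>T\<close> modulo \<open>A\<close>.
\<close>

lemma abelian_group_rank_exact_le:
  assumes A: "comm_group A" and B: "comm_group B" and C: "comm_group C"
    and g: "g \<in> hom A B"
    and f: "f \<in> hom B C"
    and ex: "g ` carrier A = kernel B C f"
  shows "abelian_group_rank B \<le> abelian_group_rank A + abelian_group_rank C"
proof (rule abelian_group_rank_le)
  interpret A: comm_group A by fact
  interpret B: comm_group B by fact
  interpret C: comm_group C by fact
  fix S assume S: "int_independent B S"
  then have finS: "finite S" "S \<subseteq> carrier B"
    by (rule int_independent_finite, rule int_independent_carrier)
  have fC: "f \<in> S \<rightarrow> carrier C" using f finS by (auto simp: hom_in_carrier)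
  define P where "P = {T. T \<subseteq> S \<and> indep_family C f T}"
  have "finite P" unfolding P_def using finS by auto
  moreover have "{} \<in> P" by (auto simp: P_def indep_family_def)
  ultimately obtain T where T: "T \<in> P" and max: "\<And>T'. T' \<in> P \<Longrightarrow> T \<subseteq> T' \<Longrightarrow> T' = T"
    using finite_has_maximal[of P] by (metis empty_iff)
  have TS: "T \<subseteq> S" "finite T" using T finS by (auto simp: P_def finite_subset)
  have TI: "indep_family C f T" using T by (simp add: P_def)
  have "\<exists>c :: _ \<Rightarrow> int. finprod C (\<lambda>i. f i [^]\<^bsub>C\<^esub> c i) S = \<one>\<^bsub>C\<^esub> \<and> c s \<noteq> 0 \<and> (\<forall>i\<in>S - T - {s}. c i = 0)"
    if s: "s \<in> S - T" for s
  proof -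
    have "insert s T \<notin> P" using max[of "insert s T"] s by blast
    then have "\<not> indep_family C f (insert s T)" using TS s by (auto simp: P_def)
    then obtain c :: "_ \<Rightarrow> int" where c: "finprod C (\<lambda>i. f i [^]\<^bsub>C\<^esub> c i) (insert s T) = \<one>\<^bsub>C\<^esub>"
        "\<exists>i\<in>insert s T. c i \<noteq> 0"
      using TS s fC unfolding indep_family_def by fast
    have fT: "f \<in> T \<rightarrow> carrier C" using fC TS by auto
    \<comment> \<open>Otherwise the relation would involve only T, which is independent.\<close>
    have cs: "c s \<noteq> 0"
    proof
      assume 0: "c s = 0"
      have "finprod C (\<lambda>i. f i [^]\<^bsub>C\<^esub> c i) (insert s T)
         = f s [^]\<^bsub>C\<^esub> c s \<otimes>\<^bsub>C\<^esub> finprod C (\<lambda>i. f i [^]\<^bsub>C\<^esub> c i) T"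
        using TS s fC fT by (intro C.finprod_insert) auto
      also have "\<dots> = finprod C (\<lambda>i. f i [^]\<^bsub>C\<^esub> c i) T"
        using 0 fT by (auto simp: C.finprod_closed Pi_def)
      finally have "finprod C (\<lambda>i. f i [^]\<^bsub>C\<^esub> c i) T = \<one>\<^bsub>C\<^esub>" using c by simp
      then have "\<forall>i\<in>T. c i = 0" by (rule indep_familyD[OF TI])
      with 0 c(2) show False by auto
    qed
    \<comment> \<open>Extension by zero puts all relations over the common index set S, as the later
      exchange of products requires.\<close>
    have "finprod C (\<lambda>i. f i [^]\<^bsub>C\<^esub> (if i \<in> insert s T then c i else 0)) S
        = finprod C (\<lambda>i. f i [^]\<^bsub>C\<^esub> c i) (insert s T)"
      using finS TS s fC by (intro C.finprod_mono_neutral_cong_right) (auto simp: Pi_def)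
    with c cs show ?thesis
      by (intro exI[of _ "\<lambda>i. if i \<in> insert s T then c i else 0"]) auto
  qed
  then obtain c :: "_ \<Rightarrow> _ \<Rightarrow> int" where c:
     "\<And>s. s \<in> S - T \<Longrightarrow> finprod C (\<lambda>i. f i [^]\<^bsub>C\<^esub> c s i) S = \<one>\<^bsub>C\<^esub>"
     "\<And>s. s \<in> S - T \<Longrightarrow> c s s \<noteq> 0" "\<And>s i. s \<in> S - T \<Longrightarrow> i \<in> S - T - {s} \<Longrightarrow> c s i = 0"
    by metis
  define b where "b = (\<lambda>s. finprod B (\<lambda>i. i [^]\<^bsub>B\<^esub> c s i) S)"
  have "b s \<in> kernel B C f" if "s \<in> S - T" for s
    using c(1)[OF that] finS hom_finprod_int_pow[OF B C f, of "\<lambda>i. i" S "c s"]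
    unfolding kernel_def b_def by (auto intro!: B.finprod_closed)
  then have "\<exists>a\<in>carrier A. g a = b s" if "s \<in> S - T" for s
    using that unfolding ex[symmetric] by (metis imageE)
  then obtain a where a: "\<And>s. s \<in> S - T \<Longrightarrow> a s \<in> carrier A" "\<And>s. s \<in> S - T \<Longrightarrow> g (a s) = b s" by metis
  have "indep_family A a (S - T)"
    unfolding indep_family_def
  proof (intro conjI allI impI)
    show "finite (S - T)" using finS by simp
    show "a \<in> S - T \<rightarrow> carrier A" using a by auto
    fix d :: "_ \<Rightarrow> int" assume 1: "finprod A (\<lambda>i. a i [^]\<^bsub>A\<^esub> d i) (S - T) = \<one>\<^bsub>A\<^esub>"
    have "\<one>\<^bsub>B\<^esub> = g (finprod A (\<lambda>i. a i [^]\<^bsub>A\<^esub> d i) (S - T))"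
      unfolding 1 using hom_one[OF g A.is_group B.is_group] by simp
    also have "\<dots> = finprod B (\<lambda>i. g (a i) [^]\<^bsub>B\<^esub> d i) (S - T)"
      by (rule hom_finprod_int_pow[OF A B g]) (use a in auto)
    also have "\<dots> = finprod B (\<lambda>k. finprod B (\<lambda>i. i [^]\<^bsub>B\<^esub> c k i) S [^]\<^bsub>B\<^esub> d k) (S - T)"
      using a finS unfolding b_def
      by (intro B.finprod_cong') (auto intro!: B.finprod_closed B.int_pow_closed)
    also have "\<dots> = finprod B (\<lambda>i. i [^]\<^bsub>B\<^esub> (\<Sum>k\<in>S - T. c k i * d k)) S"
      using finS by (intro B.finprod_int_pow_swap) auto
    finally have 2: "\<forall>i\<in>S. (\<Sum>k\<in>S - T. c k i * d k) = 0"
      by (intro int_independentD[OF S]) simp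
    show "\<forall>i\<in>S - T. d i = 0"
    proof
      fix i assume i: "i \<in> S - T"
      \<comment> \<open>Restricted to S - T the coefficient matrix is diagonal with nonzero diagonal
        entries.\<close>
      have "(\<Sum>k\<in>S - T. c k i * d k) = (\<Sum>k\<in>{i}. c k i * d k)"
        using i finS c(3) by (intro sum.mono_neutral_right) auto
      then show "d i = 0" using 2 i c(2) by simp
    qed
  qed
  then have "enat (card (S - T)) \<le> abelian_group_rank A" by (rule indep_family_card_le_rank[OF A])
  moreover have "enat (card T) \<le> abelian_group_rank C" by (rule indep_family_card_le_rank[OF C TI])
  moreover have "card S = card (S - T) + card T"
    using TS finS by (simp add: card_Diff_subset card_mono)
  ultimately show "enat (card S) \<le> abelian_group_rank A + abelian_group_rank C"
    by (metis add_mono plus_enat_simps(1))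
qed

lemma abelian_group_rank_trivial:
  assumes "trivial_group G"
  shows "abelian_group_rank G = 0"
proof -
  have G: "group G" "carrier G = {\<one>\<^bsub>G\<^esub>}" using assms by (auto simp: trivial_group_def)
  interpret group G by fact
  interpret comm_group G by (rule group_comm_groupI) (use G in auto)
  have "abelian_group_rank G \<le> 0"
  proof (rule abelian_group_rank_le)
    fix S assume S: "int_independent G S"
    then have SG: "S \<subseteq> {\<one>\<^bsub>G\<^esub>}" using G int_independent_carrier[OF S] by auto
    have "finprod G (\<lambda>x. x [^]\<^bsub>G\<^esub> (1::int)) S = \<one>\<^bsub>G\<^esub>"
      using SG by (intro finprod_one_eqI) auto
    then have "\<forall>x\<in>S. (1::int) = 0" by (rule int_independentD[OF S])
    then have "S = {}" by auto
    then show "enat (card S) \<le> 0" by (simp add: zero_enat_def)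
  qed
  then show ?thesis by simp
qed

lemma abelian_group_rank_iso_le:
  assumes "comm_group A" "comm_group B" "A \<cong> B"
  shows "abelian_group_rank A \<le> abelian_group_rank B"
proof (rule abelian_group_rank_le)
  fix S assume S: "int_independent A S"
  interpret A: comm_group A by fact
  interpret B: comm_group B by fact
  obtain h where h: "h \<in> iso A B" using assms(3) by (auto simp: is_iso_def)
  then have hh: "h \<in> hom A B" "inj_on h (carrier A)" by (auto simp: iso_def bij_betw_def)
  have finS: "finite S" "S \<subseteq> carrier A"
    using int_independent_finite[OF S] int_independent_carrier[OF S] by auto
  have "indep_family B h S"
    unfolding indep_family_def
  proof (intro conjI allI impI)
    show "finite S" "h \<in> S \<rightarrow> carrier B" using hh finS by (auto simp: hom_in_carrier)
    fix c :: "_ \<Rightarrow> int" assume "finprod B (\<lambda>i. h i [^]\<^bsub>B\<^esub> c i) S = \<one>\<^bsub>B\<^esub>"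
    then have "h (finprod A (\<lambda>i. i [^]\<^bsub>A\<^esub> c i) S) = h \<one>\<^bsub>A\<^esub>"
      using hom_finprod_int_pow[OF assms(1,2) hh(1), of "\<lambda>i. i" S c] finS
        hom_one[OF hh(1) A.is_group B.is_group] by auto
    moreover have "finprod A (\<lambda>i. i [^]\<^bsub>A\<^esub> c i) S \<in> carrier A"
      using finS by (intro A.finprod_closed) auto
    ultimately have "finprod A (\<lambda>i. i [^]\<^bsub>A\<^esub> c i) S = \<one>\<^bsub>A\<^esub>"
      using hh(2) by (simp add: inj_on_eq_iff)
    then show "\<forall>i\<in>S. c i = 0" by (rule int_independentD[OF S])
  qed
  then show "enat (card S) \<le> abelian_group_rank B" by (rule indep_family_card_le_rank[OF assms(2)])
qed

lemma abelian_group_rank_iso: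
  assumes "comm_group A" "comm_group B" "A \<cong> B"
  shows "abelian_group_rank A = abelian_group_rank B"
proof (rule antisym)
  have "B \<cong> A"
    using assms(1,3) comm_group.axioms(2) group.iso_sym by blast
  then show "abelian_group_rank B \<le> abelian_group_rank A"
    by (rule abelian_group_rank_iso_le[OF assms(2,1)])
qed (rule abelian_group_rank_iso_le[OF assms])

lemma abelian_group_rank_integer_group: "abelian_group_rank integer_group = 1"
proof (rule antisym)
  interpret comm_group integer_group by (rule abelian_integer_group)
  show "abelian_group_rank integer_group \<le> 1"
  proof (rule abelian_group_rank_le, rule ccontr)
    fix S assume S: "int_independent integer_group S" and "\<not> enat (card S) \<le> 1"
    then have "\<not> card S \<le> 1" by (simp add: one_enat_def)
    then obtain x y where xy: "x \<in> S" "y \<in> S" "x \<noteq> y"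
      using card_le_Suc0_iff_eq[OF int_independent_finite[OF S]] by auto
    have I: "indep_family integer_group (\<lambda>x. x) {x, y}"
      by (rule indep_family_subset[OF abelian_integer_group S[unfolded int_independent_iff_indep_family]])
        (use xy in auto)
    \<comment> \<open>Any two integers satisfy y x - x y = 0; independence would then force both to
      be zero, hence equal.\<close>
    define c where "c = (\<lambda>i. if i = x then y else - x)"
    have "finprod integer_group (\<lambda>i. i [^]\<^bsub>integer_group\<^esub> c i) {x, y} = \<one>\<^bsub>integer_group\<^esub>"
      using xy by (simp add: c_def)
    then have "\<forall>i\<in>{x, y}. c i = 0" by (rule indep_familyD[OF I])
    then have "c x = 0" "c y = 0" by auto
    with xy show False by (auto simp: c_def split: if_splits)
  qed
  have "indep_family integer_group (\<lambda>x. x) {1}"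
    by (auto simp: indep_family_def)
  from indep_family_card_le_rank[OF abelian_integer_group this]
  show "1 \<le> abelian_group_rank integer_group" by (simp add: one_enat_def)
qed

section \<open>The homology of a product with a Euclidean space\<close>

text \<open>In the long exact sequence of the triple, both neighbours of the boundary map are
  homology groups of the pair (X, T), which vanish.\<close>

lemma iso_hom_relboundary_trivial:
  assumes "T \<subseteq> S" and triv: "\<And>q. trivial_group (relative_homology_group q X T)"
  shows "hom_relboundary p X S T
    \<in> iso (relative_homology_group p X S) (relative_homology_group (p - 1) (subtopology X S) T)"
proof -
  let ?d = "hom_relboundary p X S T"
  let ?G = "relative_homology_group p X S"
  let ?H = "relative_homology_group (p - 1) (subtopology X S) T"
  interpret d: group_hom ?G ?H ?d
    by (simp add: group_hom_def group_hom_axioms_def group_homomorphism_hom_relboundary)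
  have hX: "hom_induced p X T X S id \<in> hom (relative_homology_group p X T) ?G"
    by (rule hom_induced_hom)
  have "kernel ?G ?H ?d = hom_induced p X T X S id ` carrier (relative_homology_group p X T)"
    using homology_exactness_triple_1[OF assms(1), of p X] by simp
  also have "\<dots> = {\<one>\<^bsub>?G\<^esub>}"
    using triv[of p] hom_one[OF hX] by (simp add: trivial_group_def)
  finally have inj: "inj_on ?d (carrier ?G)"
    by (simp add: d.inj_iff_trivial_ker)
  have hY: "hom_induced (p - 1) (subtopology X S) T X T id \<in> hom ?H (relative_homology_group (p - 1) X T)"
    by (rule hom_induced_hom)
  have "?d ` carrier ?G = kernel ?H (relative_homology_group (p - 1) X T) (hom_induced (p - 1) (subtopology X S) T X T id)"
    using homology_exactness_triple_2[OF assms(1), of p X] by simp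
  also have "\<dots> = carrier ?H"
    using triv[of "p - 1"] hom_in_carrier[OF hY] by (auto simp: kernel_def trivial_group_def)
  finally show ?thesis
    using inj d.homh by (simp add: iso_def bij_betw_def)
qed

abbreviation euclidean_times :: "nat \<Rightarrow> 'a topology \<Rightarrow> ((nat \<Rightarrow> real) \<times> 'a) topology" where
  "euclidean_times k F \<equiv> prod_topology (Euclidean_space k) F"

text \<open>The set is not cut down to the space. Coordinates from k on vanish in
  \<open>Euclidean_space k\<close>, so its trace there is the complement of the zero section, and
  relative homology sees only that trace.\<close>

definition off_zero :: "nat \<Rightarrow> ((nat \<Rightarrow> real) \<times> 'a) set" where
  "off_zero k = {z. \<exists>i<k. fst z i \<noteq> 0}"

lemma continuous_map_Euclidean_space_iff_components:
  "continuous_map X (Euclidean_space n) f \<longleftrightarrow>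
     (\<forall>i. continuous_map X euclideanreal (\<lambda>x. f x i)) \<and> (\<forall>x\<in>topspace X. \<forall>i\<ge>n. f x i = 0)"
  unfolding Euclidean_space_def continuous_map_in_subtopology continuous_map_componentwise_UNIV
  by auto

lemma continuous_map_Euclidean_coordinate:
  assumes "continuous_map X (Euclidean_space n) f"
  shows "continuous_map X euclideanreal (\<lambda>x. f x i)"
  using assms by (simp add: continuous_map_Euclidean_space_iff_components)

lemma continuous_map_euclidean_times_coordinate:
  "continuous_map (euclidean_times k F) euclideanreal (\<lambda>z. fst z i)"
  by (rule continuous_map_Euclidean_coordinate[OF continuous_map_fst])

lemma continuous_map_Euclidean_space_upd:
  assumes "continuous_map X (Euclidean_space n) f" "continuous_map X euclideanreal g" "k < n"
  shows "continuous_map X (Euclidean_space n) (\<lambda>x. (f x)(k := g x))"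
  using assms unfolding continuous_map_Euclidean_space_iff_components
  by (auto simp: fun_upd_def)

text \<open>A straight-line homotopy in one coordinate; W is the subspace to be preserved, and P can
  carry the condition for a map of pairs. It serves with c = -1 for the half space and with c = 1
  for the section at height 1.\<close>

lemma homotopic_with_slide:
  fixes F :: "'a topology" and c :: real and k :: nat
  defines "slide \<equiv> \<lambda>t z. ((fst z)(k := (1 - t) * c + t * fst z k), snd z :: 'a)"
  assumes W: "\<And>t z. t \<in> {0..1} \<Longrightarrow> z \<in> W \<Longrightarrow> slide t z \<in> W"
    and P: "\<And>t. t \<in> {0..1} \<Longrightarrow> P (slide t)"
  shows "homotopic_with P (subtopology (euclidean_times (Suc k) F) W) (subtopology (euclidean_times (Suc k) F) W)
           (\<lambda>z. ((fst z)(k := c), snd z)) id"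
  unfolding homotopic_with_def
proof (intro exI conjI allI ballI)
  let ?X = "euclidean_times (Suc k) F"
  let ?S = "subtopology ?X W"
  let ?D = "prod_topology (top_of_set {0..1::real}) ?S"
  have s: "continuous_map ?D ?X snd"
    using continuous_map_snd continuous_map_into_fulltopology by blast
  have t: "continuous_map ?D euclideanreal fst"
    using continuous_map_fst continuous_map_into_fulltopology by blast
  have fs: "continuous_map ?D (Euclidean_space (Suc k)) (\<lambda>x. fst (snd x))"
    using continuous_map_fst_of[OF s] by (simp add: o_def)
  have "continuous_map ?D ?X (\<lambda>x. slide (fst x) (snd x))"
    unfolding slide_def
  proof (intro continuous_map_pairedI continuous_map_Euclidean_space_upd)
    show "continuous_map ?D euclideanreal (\<lambda>x. (1 - fst x) * c + fst x * fst (snd x) k)"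
      by (intro continuous_intros t continuous_map_Euclidean_coordinate[OF fs])
    show "continuous_map ?D F (\<lambda>x. snd (snd x))"
      using continuous_map_snd_of[OF s] by (simp add: o_def)
  qed (auto intro: fs)
  then show "continuous_map ?D ?S (\<lambda>x. slide (fst x) (snd x))"
    by (auto simp: continuous_map_in_subtopology intro!: W)
  fix t :: real assume "t \<in> {0..1}"
  then show "P (\<lambda>x. slide (fst (t, x)) (snd (t, x)))" using P by simp
qed (auto simp: slide_def)

text \<open>Sliding coordinate k to -1 preserves \<open>C\<close>, since a negative coordinate stays
  negative and \<open>off_zero k\<close> ignores coordinate k. The slide ends inside
  \<open>C\<close>, so the pair deforms into (C, C).\<close>

lemma trivial_relative_homology_half:
  fixes F :: "'a topology" and k :: nat
  defines "C \<equiv> {z :: (nat \<Rightarrow> real) \<times> 'a. fst z k < 0} \<union> off_zero k"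
  shows "trivial_group (relative_homology_group p (euclidean_times (Suc k) F) C)"
proof (rule trivial_relative_homology_group_gen[where f = "\<lambda>z. ((fst z)(k := -1), snd z)"])
  let ?X = "euclidean_times (Suc k) F"
  have neg: "(1 - t) * (-1) + t * y < 0" if "y < 0" "t \<in> {0..1}" for t y :: real
  proof (cases "t = 0")
    case False
    with that have "t * y < 0" by (simp add: mult_pos_neg)
    moreover have "(1 - t) * (-1) \<le> 0" using that by simp
    ultimately show ?thesis by linarith
  qed simp
  have H: "homotopic_with (\<lambda>h. True) (subtopology ?X W) (subtopology ?X W) (\<lambda>z. ((fst z)(k := -1), snd z)) id"
    if "W = UNIV \<or> W = C" for W
    by (rule homotopic_with_slide) (use that neg in \<open>auto simp: C_def off_zero_def\<close>)
  from H[of C] show "homotopic_with (\<lambda>h. True) (subtopology ?X C) (subtopology ?X C) (\<lambda>z. ((fst z)(k := -1), snd z)) id"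
    by simp
  from H[of UNIV] show H1: "homotopic_with (\<lambda>h. True) ?X ?X (\<lambda>z. ((fst z)(k := -1), snd z)) id"
    by simp
  show "continuous_map ?X (subtopology ?X C) (\<lambda>z. ((fst z)(k := -1), snd z))"
    using homotopic_with_imp_continuous_maps[OF H1]
    by (auto simp: continuous_map_in_subtopology C_def)
qed

text \<open>
  With \<open>X = \<real>\<^sup>k\<^sup>+\<^sup>1 \<times> F\<close>, \<open>A = {x \<noteq> 0}\<close> and \<open>C = {x\<^sub>k < 0} \<union> {(x\<^sub>0, \<dots>, x\<^sub>k\<^sub>-\<^sub>1) \<noteq> 0}\<close>, the
  homology of \<open>(X, C)\<close> vanishes, so that of \<open>(X, A)\<close> is the shifted homology of \<open>(A, C)\<close>.
  Excising \<open>{x\<^sub>k < 0}\<close> from the latter leaves a pair that is homotopy equivalent to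
  \<open>(\<real>\<^sup>k \<times> F, {x \<noteq> 0})\<close>.
\<close>

lemma relative_homology_off_zero_Suc:
  fixes F :: "'a topology"
  shows "relative_homology_group p (euclidean_times (Suc k) F) (off_zero (Suc k))
     \<cong> relative_homology_group (p - 1) (euclidean_times k F) (off_zero k)"
proof -
  let ?X = "euclidean_times (Suc k) F"
  let ?A = "off_zero (Suc k) :: ((nat \<Rightarrow> real) \<times> 'a) set"
  let ?Z = "{z :: (nat \<Rightarrow> real) \<times> 'a. fst z k < 0}"
  let ?C = "?Z \<union> off_zero k"
  have CA: "?C \<subseteq> ?A" by (auto simp: off_zero_def less_Suc_eq)
  have ck: "continuous_map ?X euclideanreal (\<lambda>z. fst z i)" for i
    by (rule continuous_map_euclidean_times_coordinate)
  have op: "openin ?X {z \<in> topspace ?X. fst z i \<in> U}" if "open U" for U i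
    by (rule openin_continuous_map_preimage[OF ck]) (use that in simp)
  have oC: "openin (subtopology ?X ?A) (topspace (subtopology ?X ?A) \<inter> ?C)"
  proof -
    have "openin ?X ({z \<in> topspace ?X. fst z k \<in> {..<0}} \<union> (\<Union>i<k. {z \<in> topspace ?X. fst z i \<in> - {0}}))"
      using op[of "{..<0}"] op[of "- {0}"] by (intro openin_Un openin_Union) auto
    also have "\<dots> = topspace ?X \<inter> ?C" by (auto simp: off_zero_def)
    finally have "openin (subtopology ?X ?A) (topspace ?X \<inter> ?C \<inter> ?A)"
      by (simp add: openin_subtopology_Int)
    also have "topspace ?X \<inter> ?C \<inter> ?A = topspace (subtopology ?X ?A) \<inter> ?C" by auto
    finally show ?thesis .
  qed
  have cZ: "subtopology ?X ?A closure_of ?Z \<subseteq> subtopology ?X ?A interior_of ?C"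
  proof -
    have "closedin ?X {z \<in> topspace ?X. fst z k \<in> {..0}}"
      by (rule closedin_continuous_map_preimage[OF ck]) simp
    then have cl: "closedin (subtopology ?X ?A) ({z \<in> topspace ?X. fst z k \<in> {..0}} \<inter> ?A)"
      by (rule closedin_subtopology_Int_closed[rotated, of _ _ ?A, simplified Int_commute])
    have "subtopology ?X ?A closure_of ?Z = subtopology ?X ?A closure_of (topspace (subtopology ?X ?A) \<inter> ?Z)"
      by (rule closure_of_restrict)
    also have "\<dots> \<subseteq> {z \<in> topspace ?X. fst z k \<in> {..0}} \<inter> ?A"
      by (rule closure_of_minimal[OF _ cl]) auto
    \<comment> \<open>A nonzero point whose coordinate k is exactly 0 has another nonzero
      coordinate; this places the boundary of \<open>?Z\<close> inside the open set
      \<open>?C\<close>.\<close>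
    also have "\<dots> \<subseteq> topspace (subtopology ?X ?A) \<inter> ?C"
      by (auto simp: off_zero_def less_Suc_eq)
    also have "\<dots> \<subseteq> subtopology ?X ?A interior_of (topspace (subtopology ?X ?A) \<inter> ?C)"
      by (rule interior_of_maximal[OF order_refl oC])
    also have "\<dots> = subtopology ?X ?A interior_of ?C"
      by (rule interior_of_restrict[symmetric])
    finally show ?thesis .
  qed
  let ?Y = "subtopology ?X (?A - ?Z)"
  let ?E = "euclidean_times k F"
  define f where "f = (\<lambda>z :: (nat \<Rightarrow> real) \<times> 'a. ((fst z)(k := 0), snd z))"
  \<comment> \<open>Height 1 keeps the image away from the origin even when the first k coordinates
    are all zero.\<close>
  define g where "g = (\<lambda>z :: (nat \<Rightarrow> real) \<times> 'a. ((fst z)(k := 1), snd z))"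
  have 1: "relative_homology_group p ?X ?A \<cong> relative_homology_group (p - 1) (subtopology ?X ?A) ?C"
    using iso_hom_relboundary_trivial[OF CA trivial_relative_homology_half] by (rule is_isoI)
  have 2: "relative_homology_group (p - 1) ?Y (?C - ?Z) \<cong> relative_homology_group (p - 1) (subtopology ?X ?A) ?C"
    using homology_excision_axiom[OF cZ CA, of "p - 1"] CA
    by (intro is_isoI) (simp add: subtopology_subtopology Int_absorb1 Diff_subset)
  have 3: "relative_homology_group (p - 1) ?Y (?C - ?Z) \<cong> relative_homology_group (p - 1) ?E (off_zero k)"
  proof (rule homotopy_equivalent_space_imp_isomorphic_relative_homology_groups)
    show "f \<in> ?C - ?Z \<rightarrow> off_zero k" "g \<in> off_zero k \<rightarrow> ?C - ?Z"
      by (auto simp: f_def g_def off_zero_def)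
    show cf: "continuous_map ?Y ?E f"
      unfolding f_def
    proof (intro continuous_map_pairedI)
      show "continuous_map ?Y F snd"
        by (intro continuous_map_from_subtopology continuous_map_snd)
      have "continuous_map ?Y euclideanreal (\<lambda>z. fst z i)" for i
        by (intro continuous_map_from_subtopology ck)
      then show "continuous_map ?Y (Euclidean_space k) (\<lambda>z. (fst z)(k := 0))"
        unfolding continuous_map_Euclidean_space_iff_components
        by (auto simp: fun_upd_def topspace_Euclidean_space)
    qed
    show cg: "continuous_map ?E ?Y g"
    proof -
      have "continuous_map ?E ?X g"
        unfolding g_def
      proof (intro continuous_map_pairedI continuous_map_snd)
        have "continuous_map ?E euclideanreal (\<lambda>z. fst z i)" for i
          by (rule continuous_map_euclidean_times_coordinate)
        then show "continuous_map ?E (Euclidean_space (Suc k)) (\<lambda>z. (fst z)(k := 1))"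
          unfolding continuous_map_Euclidean_space_iff_components
          by (auto simp: fun_upd_def topspace_Euclidean_space)
      qed
      then show ?thesis
        by (auto simp: continuous_map_in_subtopology g_def off_zero_def)
    qed
    have gf: "g \<circ> f = (\<lambda>z. ((fst z)(k := 1), snd z))" by (auto simp: g_def f_def)
    show "homotopic_with (\<lambda>h. h \<in> ?C - ?Z \<rightarrow> ?C - ?Z) ?Y ?Y (g \<circ> f) id"
      unfolding gf
    proof (rule homotopic_with_slide)
      fix t :: real assume t: "t \<in> {0..1}"
      show "((fst z)(k := (1 - t) * 1 + t * fst z k), snd z) \<in> ?A - ?Z" if z: "z \<in> ?A - ?Z" for z :: "_ \<times> 'a"
      \<comment> \<open>For t < 1 the new coordinate is strictly positive, which alone makes the
        point nonzero; at t = 1 the slide is the identity.\<close>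
      proof (cases "t = 1")
        case True
        then show ?thesis using z by simp
      next
        case False
        then have "(1 - t) * 1 + t * fst z k > 0"
          using t z by (intro add_pos_nonneg) auto
        then show ?thesis by (auto simp: off_zero_def)
      qed
      show "(\<lambda>z. ((fst z)(k := (1 - t) * 1 + t * fst z k), snd z)) \<in> ?C - ?Z \<rightarrow> ?C - ?Z"
      proof
        fix z :: "_ \<times> 'a" assume z: "z \<in> ?C - ?Z"
        then have "(1 - t) * 1 + t * fst z k \<ge> 0" using t by auto
        with z show "((fst z)(k := (1 - t) * 1 + t * fst z k), snd z) \<in> ?C - ?Z"
          by (auto simp: off_zero_def)
      qed
    qed
    show "homotopic_with (\<lambda>h. h \<in> off_zero k \<rightarrow> off_zero k) ?E ?E (f \<circ> g) id"
    proof (rule homotopic_with_equal)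
      show "f \<circ> g \<in> off_zero k \<rightarrow> off_zero k" by (auto simp: f_def g_def off_zero_def)
      show "continuous_map ?E ?E (f \<circ> g)" using cf cg continuous_map_compose by blast
      show "(f \<circ> g) x = id x" if "x \<in> topspace ?E" for x
        using that by (auto simp: f_def g_def topspace_Euclidean_space fun_eq_iff)
    qed auto
  qed
  show ?thesis
    by (rule iso_trans[OF 1 iso_trans[OF group.iso_sym[OF group_relative_homology_group 2] 3]])
qed

text \<open>Scaling the Euclidean factor linearly to zero deforms the product onto the copy of F
  over the origin.\<close>

lemma homology_euclidean_times:
  "homology_group p (euclidean_times k F) \<cong> homology_group p F"
proof (rule homotopy_equivalent_space_imp_isomorphic_homology_groups)
  let ?E = "euclidean_times k F"
  let ?g = "\<lambda>y. (\<lambda>_::nat. 0::real, y)"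
  show "?E homotopy_equivalent_space F"
    unfolding homotopy_equivalent_space_def
  proof (intro exI conjI)
    show cs: "continuous_map ?E F snd" by (rule continuous_map_snd)
    show cg: "continuous_map F ?E ?g"
      by (intro continuous_map_pairedI) (auto simp: topspace_Euclidean_space)
    show "homotopic_with (\<lambda>x. True) F F (snd \<circ> ?g) id"
      by (rule homotopic_with_equal) (auto simp: o_def id_def)
    let ?D = "prod_topology (top_of_set {0..1::real}) ?E"
    show "homotopic_with (\<lambda>x. True) ?E ?E (?g \<circ> snd) id"
      unfolding homotopic_with_def
    proof (intro exI conjI allI ballI)
      have s: "continuous_map ?D ?E snd" by (rule continuous_map_snd)
      have t: "continuous_map ?D euclideanreal fst"
        using continuous_map_fst continuous_map_into_fulltopology by blast
      have fs: "continuous_map ?D (Euclidean_space k) (\<lambda>x. fst (snd x))"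
        using continuous_map_fst_of[OF s] by (simp add: o_def)
      show "continuous_map ?D ?E (\<lambda>x. (\<lambda>i. fst x * fst (snd x) i, snd (snd x)))"
      proof (intro continuous_map_pairedI)
        show "continuous_map ?D F (\<lambda>x. snd (snd x))"
          using continuous_map_snd_of[OF s] by (simp add: o_def)
        show "continuous_map ?D (Euclidean_space k) (\<lambda>x i. fst x * fst (snd x) i)"
          unfolding continuous_map_Euclidean_space_iff_components
          using fs by (auto intro!: continuous_intros t continuous_map_Euclidean_coordinate[OF fs]
            simp: topspace_Euclidean_space)
      qed
    qed auto
  qed
qed

text \<open>Iterates the shift by one dimension down to k = 0, where \<open>off_zero\<close> is
  empty and the relative group is an absolute one. Degrees are integers, so p < k needs no separate
  treatment.\<close>

lemma relative_homology_off_zero: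
  fixes F :: "'a topology"
  shows "relative_homology_group p (euclidean_times k F) (off_zero k) \<cong> homology_group (p - int k) F"
proof (induction k arbitrary: p)
  case 0
  have "off_zero 0 = ({} :: ((nat \<Rightarrow> real) \<times> 'a) set)" by (simp add: off_zero_def)
  then show ?case using homology_euclidean_times[of p 0 F] by simp
next
  case (Suc k)
  have p: "p - 1 - int k = p - int (Suc k)" by simp
  show ?case
    by (rule iso_trans[OF relative_homology_off_zero_Suc Suc[of "p - 1", unfolded p]])
qed

section \<open>Reflections and rotations\<close>

lemma mat_eqI_vec:
  fixes A B :: "real mat"
  assumes "A \<in> carrier_mat n m" "B \<in> carrier_mat n m"
    and "\<And>x. x \<in> carrier_vec m \<Longrightarrow> A *\<^sub>v x = B *\<^sub>v x"
  shows "A = B"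
proof (rule eq_matI)
  fix i j assume "i < dim_row B" "j < dim_col B"
  then have ij: "i < n" "j < m" using assms by auto
  have *: "(M *\<^sub>v unit_vec m j) $ i = M $$ (i, j)" if "M \<in> carrier_mat n m" for M :: "real mat"
    using that ij by (auto simp: mult_mat_vec_def)
  show "A $$ (i, j) = B $$ (i, j)"
    using *[OF assms(1)] *[OF assms(2)] assms(3)[of "unit_vec m j"] by simp
qed (use assms in auto)

lemma mult_mat_vec_unit:
  fixes A :: "real mat"
  assumes "A \<in> carrier_mat n m" "j < m" "i < n"
  shows "(A *\<^sub>v unit_vec m j) $ i = A $$ (i, j)"
  using assms by (auto simp: mult_mat_vec_def)

lemma scalar_prod_mult_mat_vec:
  fixes A :: "real mat"
  assumes "A \<in> carrier_mat n m" "x \<in> carrier_vec m" "y \<in> carrier_vec n"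
  shows "(A *\<^sub>v x) \<bullet> y = x \<bullet> (transpose_mat A *\<^sub>v y)"
proof -
  have "(A *\<^sub>v x) \<bullet> y = y \<bullet> (A *\<^sub>v x)"
    using assms by (intro comm_scalar_prod) auto
  also have "\<dots> = (transpose_mat A *\<^sub>v y) \<bullet> x"
    using assms by (simp add: transpose_vec_mult_scalar)
  also have "\<dots> = x \<bullet> (transpose_mat A *\<^sub>v y)"
    using assms by (intro comm_scalar_prod) auto
  finally show ?thesis .
qed

lemma scalar_prod_isometry:
  fixes A :: "real mat"
  assumes A: "A \<in> carrier_mat n n" "transpose_mat A * A = 1\<^sub>m n"
    and "x \<in> carrier_vec n" "y \<in> carrier_vec n"
  shows "(A *\<^sub>v x) \<bullet> (A *\<^sub>v y) = x \<bullet> y"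
  using assms by (simp add: scalar_prod_mult_mat_vec[of A n n] assoc_mult_mat_vec[symmetric, of _ n n _ n])

lemma scalar_prod_self_eq_0:
  fixes v :: "real vec"
  assumes "v \<in> carrier_vec n"
  shows "v \<bullet> v = 0 \<longleftrightarrow> v = 0\<^sub>v n"
proof
  assume "v \<bullet> v = 0"
  then have "(\<Sum>i = 0..<n. v $ i * v $ i) = 0" using assms by (simp add: scalar_prod_def)
  then have "\<forall>i\<in>{0..<n}. v $ i * v $ i = 0" by (subst (asm) sum_nonneg_eq_0_iff) auto
  then show "v = 0\<^sub>v n" using assms by (intro eq_vecI) auto
qed (use assms in simp)

text \<open>The reflection in the hyperplane orthogonal to v. Dividing by
  \<open>v \<bullet> v\<close> instead of normalising v keeps the entries rational in v, which later
  gives continuity in the parameter directly.\<close>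

definition householder :: "real vec \<Rightarrow> real mat" where
  "householder v = mat (dim_vec v) (dim_vec v)
     (\<lambda>(i, j). (if i = j then 1 else 0) - 2 * v $ i * v $ j / (v \<bullet> v))"

lemma householder_carrier: "v \<in> carrier_vec n \<Longrightarrow> householder v \<in> carrier_mat n n"
  by (auto simp: householder_def)

lemma transpose_householder: "transpose_mat (householder v) = householder v"
  by (rule eq_matI) (auto simp: householder_def)

lemma householder_mult_vec:
  assumes "v \<in> carrier_vec n" "x \<in> carrier_vec n"
  shows "householder v *\<^sub>v x = x - (2 * (v \<bullet> x) / (v \<bullet> v)) \<cdot>\<^sub>v v"
proof (rule eq_vecI)
  fix i assume "i < dim_vec (x - (2 * (v \<bullet> x) / (v \<bullet> v)) \<cdot>\<^sub>v v)"
  then have i: "i < n" using assms by simp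
  have "(householder v *\<^sub>v x) $ i
      = (\<Sum>j = 0..<n. ((if i = j then 1 else 0) - 2 * v $ i * v $ j / (v \<bullet> v)) * x $ j)"
    using assms i by (simp add: householder_def mult_mat_vec_def scalar_prod_def)
  also have "\<dots> = (\<Sum>j = 0..<n. if i = j then x $ j else 0)
      - (\<Sum>j = 0..<n. (2 * v $ i / (v \<bullet> v)) * (v $ j * x $ j))"
    unfolding sum_subtractf[symmetric] by (intro sum.cong) (auto simp: field_simps)
  also have "\<dots> = x $ i - (2 * v $ i / (v \<bullet> v)) * (v \<bullet> x)"
    using i assms by (simp add: scalar_prod_def sum_distrib_left)
  finally show "(householder v *\<^sub>v x) $ i = (x - (2 * (v \<bullet> x) / (v \<bullet> v)) \<cdot>\<^sub>v v) $ i"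
    using i assms by (simp add: field_simps)
qed (use assms in \<open>auto simp: householder_def\<close>)

lemma householder_fix:
  assumes "v \<in> carrier_vec n" "x \<in> carrier_vec n" "v \<bullet> x = 0"
  shows "householder v *\<^sub>v x = x"
  using assms by (simp add: householder_mult_vec[of v n]) (auto intro: eq_vecI)

lemma householder_square:
  assumes "v \<in> carrier_vec n" "v \<noteq> 0\<^sub>v n"
  shows "householder v * householder v = 1\<^sub>m n"
proof (rule mat_eqI_vec)
  have c: "householder v \<in> carrier_mat n n" using assms by (rule_tac householder_carrier)
  then show "householder v * householder v \<in> carrier_mat n n" by simp
  fix x :: "real vec" assume x: "x \<in> carrier_vec n"
  have vv: "v \<bullet> v \<noteq> 0" using assms scalar_prod_self_eq_0 by auto
  define c where "c = 2 * (v \<bullet> x) / (v \<bullet> v)"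
  have "householder v * householder v *\<^sub>v x = householder v *\<^sub>v (x - c \<cdot>\<^sub>v v)"
    using x assms c by (simp add: assoc_mult_mat_vec[of _ n n _ n] householder_mult_vec[of v n] c_def)
  also have "\<dots> = (x - c \<cdot>\<^sub>v v) - (2 * (v \<bullet> (x - c \<cdot>\<^sub>v v)) / (v \<bullet> v)) \<cdot>\<^sub>v v"
    using x assms by (intro householder_mult_vec) auto
  also have "2 * (v \<bullet> (x - c \<cdot>\<^sub>v v)) / (v \<bullet> v) = - c"
    using x assms vv by (simp add: scalar_prod_minus_distrib[of _ n] c_def field_simps)
  also have "(x - c \<cdot>\<^sub>v v) - (- c) \<cdot>\<^sub>v v = 1\<^sub>m n *\<^sub>v x"
    using x assms by (intro eq_vecI) auto
  finally show "householder v * householder v *\<^sub>v x = 1\<^sub>m n *\<^sub>v x" .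
qed simp

text \<open>The rule that conjugating the reflection in v by g gives the reflection in g v,
  multiplied out so that no inverse appears.\<close>

lemma householder_conj:
  assumes g: "g \<in> carrier_mat n n" "transpose_mat g * g = 1\<^sub>m n" and v: "v \<in> carrier_vec n"
  shows "householder (g *\<^sub>v v) * g = g * householder v"
proof (rule mat_eqI_vec)
  have gv: "g *\<^sub>v v \<in> carrier_vec n" using g v by simp
  have c: "householder v \<in> carrier_mat n n" "householder (g *\<^sub>v v) \<in> carrier_mat n n"
    using v gv by (rule_tac householder_carrier, simp)+
  show "householder (g *\<^sub>v v) * g \<in> carrier_mat n n" "g * householder v \<in> carrier_mat n n"
    using g c by auto
  fix x :: "real vec" assume x: "x \<in> carrier_vec n"
  define k where "k = 2 * (v \<bullet> x) / (v \<bullet> v)"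
  have "householder (g *\<^sub>v v) * g *\<^sub>v x = g *\<^sub>v x - k \<cdot>\<^sub>v (g *\<^sub>v v)"
    using x g v c gv
    by (simp add: assoc_mult_mat_vec[of _ n n _ n] householder_mult_vec[of _ n] scalar_prod_isometry k_def)
  also have "\<dots> = g *\<^sub>v (x - k \<cdot>\<^sub>v v)"
    using x g v by (simp add: mult_minus_distrib_mat_vec[of _ n n] mult_mat_vec[of _ n n])
  also have "\<dots> = g * householder v *\<^sub>v x"
    using x g v c by (simp add: assoc_mult_mat_vec[of _ n n _ n] householder_mult_vec[of _ n] k_def)
  finally show "householder (g *\<^sub>v v) * g *\<^sub>v x = g * householder v *\<^sub>v x" .
qed

lemma householder_smult:
  assumes "c \<noteq> 0"
  shows "householder (c \<cdot>\<^sub>v v) = householder v"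
proof (rule eq_matI)
  fix i j assume "i < dim_row (householder v)" "j < dim_col (householder v)"
  then have "i < dim_vec v" "j < dim_vec v" by (auto simp: householder_def)
  moreover have "(c \<cdot>\<^sub>v v) \<bullet> (c \<cdot>\<^sub>v v) = c * c * (v \<bullet> v)"
    by (simp add: scalar_prod_def sum_distrib_left mult_ac)
  ultimately show "householder (c \<cdot>\<^sub>v v) $$ (i, j) = householder v $$ (i, j)"
    using assms by (simp add: householder_def mult_ac)
qed (auto simp: householder_def)

text \<open>For vectors of equal length the hyperplane orthogonal to v - w is their bisector, and
  reflection in it exchanges them.\<close>

lemma householder_swap:
  assumes v: "v \<in> carrier_vec n" and w: "w \<in> carrier_vec n" and eq: "v \<bullet> v = w \<bullet> w" and ne: "v \<noteq> w"
  shows "householder (v - w) *\<^sub>v v = w"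
proof -
  have vw: "w \<bullet> v = v \<bullet> w" using v w by (rule_tac comm_scalar_prod)
  have "v - w \<noteq> 0\<^sub>v n"
  proof
    assume "v - w = 0\<^sub>v n"
    then have "(v - w) $ i = 0" if "i < n" for i using that by simp
    then have "v = w" using v w by (intro eq_vecI) auto
    with ne show False by simp
  qed
  then have nz: "(v - w) \<bullet> (v - w) \<noteq> 0" using v w by (subst scalar_prod_self_eq_0[of _ n]) auto
  \<comment> \<open>Equal lengths make the reflection subtract exactly one copy of v - w from
    v.\<close>
  have 1: "(v - w) \<bullet> (v - w) = 2 * ((v - w) \<bullet> v)"
    using v w eq vw by (simp add: scalar_prod_minus_distrib[of _ n] minus_scalar_prod_distrib[of _ n])
  then have "2 * ((v - w) \<bullet> v) / ((v - w) \<bullet> (v - w)) = 1" using nz by simp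
  then have "householder (v - w) *\<^sub>v v = v - (v - w)"
    using v w by (subst householder_mult_vec[of _ n]) auto
  also have "\<dots> = w" using v w by (intro eq_vecI) auto
  finally show ?thesis .
qed

lemma det_householder_square:
  assumes "v \<in> carrier_vec n" "v \<noteq> 0\<^sub>v n"
  shows "Determinant.det (householder v) * Determinant.det (householder v) = 1"
proof -
  have c: "householder v \<in> carrier_mat n n" using assms by (rule_tac householder_carrier)
  show ?thesis unfolding det_mult[OF c c, symmetric] householder_square[OF assms] by simp
qed

text \<open>Two reflections are conjugate by a third one, so the value of their determinant is not needed.\<close>

lemma det_householder_eq:
  assumes v: "v \<in> carrier_vec n" "v \<noteq> 0\<^sub>v n" and w: "w \<in> carrier_vec n" "w \<noteq> 0\<^sub>v n"
  shows "Determinant.det (householder v) = Determinant.det (householder w)"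
proof -
  \<comment> \<open>Rescaling w to the length of v leaves its reflection unchanged and makes the
    exchanging reflection available.\<close>
  define w' where "w' = (sqrt (v \<bullet> v) / sqrt (w \<bullet> w)) \<cdot>\<^sub>v w"
  have pos: "x \<bullet> x > 0" if "x \<in> carrier_vec n" "x \<noteq> 0\<^sub>v n" for x :: "real vec"
  proof -
    have "x \<bullet> x \<ge> 0" unfolding scalar_prod_def by (intro sum_nonneg) auto
    then show ?thesis using scalar_prod_self_eq_0[OF that(1)] that(2) by auto
  qed
  have hw: "householder w' = householder w"
    using pos[OF v] pos[OF w] unfolding w'_def by (intro householder_smult) auto
  have w': "w' \<in> carrier_vec n" using w by (simp add: w'_def)
  have eq: "v \<bullet> v = w' \<bullet> w'"
    using pos[OF v] pos[OF w] w by (simp add: w'_def field_simps)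
  show ?thesis
  proof (cases "v = w'")
    case True
    then show ?thesis using hw by simp
  next
    case False
    define x where "x = v - w'"
    have x: "x \<in> carrier_vec n" using v w' by (simp add: x_def)
    have x0: "x \<noteq> 0\<^sub>v n"
    proof
      assume "x = 0\<^sub>v n"
      then have "(v - w') $ i = 0" if "i < n" for i using that by (simp add: x_def)
      then have "v = w'" using v w' by (intro eq_vecI) auto
      with False show False by simp
    qed
    have c: "householder u \<in> carrier_mat n n" if "u \<in> carrier_vec n" for u
      using that by (rule householder_carrier)
    have "householder (householder x *\<^sub>v v) * householder x = householder x * householder v"

      using householder_conj[OF c[OF x] _ v(1)] x x0
      by (simp add: transpose_householder householder_square)
    then have "householder w * householder x = householder x * householder v"
      using householder_swap[OF v(1) w' eq False] hw by (simp add: x_def)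
    then have "Determinant.det (householder w) * Determinant.det (householder x)
        = Determinant.det (householder x) * Determinant.det (householder v)"
      using c[OF v(1)] c[OF w(1)] c[OF x] by (metis det_mult)
    then show ?thesis using det_householder_square[OF x x0] by auto
  qed
qed

section \<open>Special orthogonal matrices and products of two reflections\<close>

lemma SO_mat_carrier: "G \<in> SO_mat N \<Longrightarrow> G \<in> carrier_mat N N"
  by (simp add: SO_mat_def)

lemma SO_mat_mult_transpose: "G \<in> SO_mat N \<Longrightarrow> G * transpose_mat G = 1\<^sub>m N"
  by (simp add: SO_mat_def)

lemma SO_mat_transpose_mult: "G \<in> SO_mat N \<Longrightarrow> transpose_mat G * G = 1\<^sub>m N"
  by (rule mat_mult_left_right_inverse) (auto simp: SO_mat_def)

lemma one_in_SO_mat: "1\<^sub>m N \<in> SO_mat N"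
  by (simp add: SO_mat_def)

lemma transpose_in_SO_mat: "G \<in> SO_mat N \<Longrightarrow> transpose_mat G \<in> SO_mat N"
  using SO_mat_transpose_mult[of G N] by (auto simp: SO_mat_def det_transpose)

lemma mult_in_SO_mat:
  assumes "G \<in> SO_mat N" "H \<in> SO_mat N"
  shows "G * H \<in> SO_mat N"
proof -
  have c: "G \<in> carrier_mat N N" "H \<in> carrier_mat N N" using assms by (auto simp: SO_mat_def)
  have "(G * H) * transpose_mat (G * H) = (G * H) * (transpose_mat H * transpose_mat G)"
    using c by (simp add: transpose_mult[of _ N N])
  also have "\<dots> = G * ((H * transpose_mat H) * transpose_mat G)"
    using c by (simp add: assoc_mult_mat[of _ N N _ N _ N])
  also have "\<dots> = 1\<^sub>m N"
    using assms c by (simp add: SO_mat_mult_transpose)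
  finally show ?thesis
    using assms c by (simp add: SO_mat_def det_mult[of _ N])
qed

text \<open>All reflections share one determinant, and it squares to 1, so a product of two has
  determinant 1 whatever the common value is.\<close>

lemma householder_pair_in_SO_mat:
  assumes v: "v \<in> carrier_vec n" "v \<noteq> 0\<^sub>v n" and w: "w \<in> carrier_vec n" "w \<noteq> 0\<^sub>v n"
  shows "householder v * householder w \<in> SO_mat n"
proof -
  have c: "householder v \<in> carrier_mat n n" "householder w \<in> carrier_mat n n"
    using v w by (auto intro: householder_carrier)
  have "(householder v * householder w) * transpose_mat (householder v * householder w)
      = householder v * householder w * (householder w * householder v)"
    using c by (simp add: transpose_mult[of _ n n] transpose_householder)
  also have "\<dots> = householder v * ((householder w * householder w) * householder v)"
    using c by (simp add: assoc_mult_mat[of _ n n _ n _ n])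
  also have "\<dots> = 1\<^sub>m n"
    using c v w by (simp add: householder_square)
  finally show ?thesis
    using c det_householder_eq[OF v w] det_householder_square[OF w]
    by (simp add: SO_mat_def det_mult[of _ n])
qed

section \<open>The standard complex structure\<close>

definition J1 :: "real mat" where
  "J1 = mat_of_rows_list 2 [[0, -1], [1, 0]]"

lemma J1_carrier: "J1 \<in> carrier_mat 2 2"
  by (auto simp: J1_def mat_of_rows_list_def)

lemma J1_index: "J1 $$ (0, 0) = 0" "J1 $$ (0, Suc 0) = -1" "J1 $$ (Suc 0, 0) = 1" "J1 $$ (Suc 0, Suc 0) = 0"
  by (simp_all add: J1_def mat_of_rows_list_def)

text \<open>The inclusion of the fibre over e_1: a structure B on the complement of the plane of e_0
  and e_1 is extended by the standard rotation of that plane. Iterating it produces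
  \<open>J0\<close>.\<close>

definition block_J :: "real mat \<Rightarrow> real mat" where
  "block_J B = four_block_mat J1 (0\<^sub>m 2 (dim_col B)) (0\<^sub>m (dim_row B) 2) B"

lemma J0_0: "J0 0 = J1"
  by (simp add: J0_def J1_def[symmetric]) (rule eq_matI, auto simp: J1_def mat_of_rows_list_def)

lemma J0_Suc: "J0 (Suc n) = block_J (J0 n)"
  using J1_carrier by (simp add: J0_def J1_def[symmetric] block_J_def Let_def)

lemma block_J_carrier: "B \<in> carrier_mat n n \<Longrightarrow> block_J B \<in> carrier_mat (n + 2) (n + 2)"
  using J1_carrier by (auto simp: block_J_def)

lemma J0_carrier: "J0 n \<in> carrier_mat (2 * n + 2) (2 * n + 2)"
proof (induction n)
  case 0
  then show ?case using J1_carrier by (simp add: J0_0 numeral_2_eq_2)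
next
  case (Suc n)
  then show ?case using block_J_carrier[OF Suc] by (simp add: J0_Suc)
qed

lemma block_J_index:
  assumes "B \<in> carrier_mat n n" "i < n + 2" "j < n + 2"
  shows "block_J B $$ (i, j) =
    (if i < 2 \<and> j < 2 then J1 $$ (i, j) else if i < 2 \<or> j < 2 then 0 else B $$ (i - 2, j - 2))"
  using assms J1_carrier by (auto simp: block_J_def)

lemma transpose_block_J_eq_uminus:
  assumes "B \<in> carrier_mat n n" "transpose_mat B = - B"
  shows "transpose_mat (block_J B) = - block_J B"
proof (rule eq_matI)
  have c: "block_J B \<in> carrier_mat (n + 2) (n + 2)" using assms by (intro block_J_carrier)
  fix i j assume "i < dim_row (- block_J B)" "j < dim_col (- block_J B)"
  then have ij: "i < n + 2" "j < n + 2" using c by auto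
  have B: "B $$ (b, a) = - B $$ (a, b)" if "a < n" "b < n" for a b
    using arg_cong[OF assms(2), of "\<lambda>M. M $$ (a, b)"] that assms(1) by simp
  have J: "J1 $$ (j, i) = - J1 $$ (i, j)" if "i < 2" "j < 2"
    using that by (auto simp: less_2_cases_iff J1_index)
  show "transpose_mat (block_J B) $$ (i, j) = (- block_J B) $$ (i, j)"
    using c ij assms(1) B[of "i - 2" "j - 2"] J by (auto simp: block_J_index)
qed (use block_J_carrier[OF assms(1)] in auto)

lemma J1_orthogonal: "J1 * transpose_mat J1 = 1\<^sub>m 2"
proof (rule eq_matI)
  fix i j assume "i < dim_row (1\<^sub>m 2 :: real mat)" "j < dim_col (1\<^sub>m 2 :: real mat)"
  then show "(J1 * transpose_mat J1) $$ (i, j) = 1\<^sub>m 2 $$ (i, j)"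
    using J1_carrier
    by (auto simp: less_2_cases_iff J1_index scalar_prod_def numeral_2_eq_2 less_Suc_eq)
qed (use J1_carrier in auto)

lemma transpose_J1: "transpose_mat J1 = - J1"
proof (rule eq_matI)
  fix i j assume "i < dim_row (- J1)" "j < dim_col (- J1)"
  then show "transpose_mat J1 $$ (i, j) = (- J1) $$ (i, j)"
    using J1_carrier by (auto simp: less_2_cases_iff J1_index)
qed (use J1_carrier in auto)

lemma transpose_J0: "transpose_mat (J0 n) = - J0 n"
proof (induction n)
  case (Suc n)
  then show ?case using transpose_block_J_eq_uminus[OF J0_carrier Suc] by (simp add: J0_Suc)
qed (simp add: J0_0 transpose_J1)

lemma block_J_orthogonal:
  assumes "B \<in> carrier_mat n n" "B * transpose_mat B = 1\<^sub>m n"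
  shows "block_J B * transpose_mat (block_J B) = 1\<^sub>m (n + 2)"
proof -
  have "transpose_mat (block_J B) = four_block_mat (transpose_mat J1) (0\<^sub>m 2 n) (0\<^sub>m n 2) (transpose_mat B)"
    unfolding block_J_def using assms(1) J1_carrier by (subst transpose_four_block_mat[of _ 2 2 _ n _ n]) auto
  moreover have "block_J B = four_block_mat J1 (0\<^sub>m 2 n) (0\<^sub>m n 2) B"
    using assms(1) by (simp add: block_J_def)
  ultimately show ?thesis
    using assms J1_carrier
    by (simp add: mult_four_block_mat[of _ 2 2 _ n _ n _ _ 2 _ n] J1_orthogonal add.commute)
qed

lemma J0_orthogonal: "J0 n * transpose_mat (J0 n) = 1\<^sub>m (2 * n + 2)"
proof (induction n)
  case 0
  then show ?case by (simp add: J0_0 J1_orthogonal numeral_2_eq_2)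
next
  case (Suc n)
  then show ?case using block_J_orthogonal[OF J0_carrier Suc] by (simp add: J0_Suc add.commute)
qed

lemma J0_orthogonal': "transpose_mat (J0 n) * J0 n = 1\<^sub>m (2 * n + 2)"
  by (rule mat_mult_left_right_inverse[OF J0_carrier _ J0_orthogonal]) (use J0_carrier[of n] in auto)

lemma J0_column_0:
  assumes "i < 2 * n + 2"
  shows "J0 n $$ (i, 0) = (if i = 1 then 1 else 0)"
proof (cases n)
  case 0
  then show ?thesis using assms by (auto simp: J0_0 J1_index less_Suc_eq)
next
  case (Suc m)
  then show ?thesis
    using assms block_J_index[OF J0_carrier, of i m 0]
    by (auto simp: J0_Suc J1_index less_2_cases_iff)
qed

lemma J0_column_1:
  assumes "i < 2 * n + 2"
  shows "J0 n $$ (i, 1) = (if i = 0 then -1 else 0)"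
proof (cases n)
  case 0
  then show ?thesis using assms by (auto simp: J0_0 J1_index less_Suc_eq)
next
  case (Suc m)
  then show ?thesis
    using assms block_J_index[OF J0_carrier, of i m 1]
    by (auto simp: J0_Suc J1_index less_2_cases_iff)
qed

lemma J0_mult_unit_0: "J0 n *\<^sub>v unit_vec (2 * n + 2) 0 = unit_vec (2 * n + 2) 1"
proof (rule eq_vecI)
  fix i assume "i < dim_vec (unit_vec (2 * n + 2) 1 :: real vec)"
  then show "(J0 n *\<^sub>v unit_vec (2 * n + 2) 0) $ i = unit_vec (2 * n + 2) 1 $ i"
    using mult_mat_vec_unit[OF J0_carrier, of 0 n i] J0_column_0[of i n] by simp
qed (use J0_carrier[of n] in auto)

lemma J0_mult_unit_2:
  "J0 (Suc m) *\<^sub>v unit_vec (2 * Suc m + 2) 2 = unit_vec (2 * Suc m + 2) 3"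
proof (rule eq_vecI)
  fix i assume "i < dim_vec (unit_vec (2 * Suc m + 2) 3 :: real vec)"
  then show "(J0 (Suc m) *\<^sub>v unit_vec (2 * Suc m + 2) 2) $ i = unit_vec (2 * Suc m + 2) 3 $ i"
    using mult_mat_vec_unit[OF J0_carrier, of 2 "Suc m" i] block_J_index[OF J0_carrier, of i m 2]
      J0_column_0[of "i - 2" m] by (auto simp: J0_Suc)
qed (use J0_carrier[of "Suc m"] in auto)

lemma J0_mult_unit_3:
  "J0 (Suc m) *\<^sub>v unit_vec (2 * Suc m + 2) 3 = - unit_vec (2 * Suc m + 2) 2"
proof (rule eq_vecI)
  fix i assume "i < dim_vec (- unit_vec (2 * Suc m + 2) 2 :: real vec)"
  then show "(J0 (Suc m) *\<^sub>v unit_vec (2 * Suc m + 2) 3) $ i = (- unit_vec (2 * Suc m + 2) 2) $ i"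
    using mult_mat_vec_unit[OF J0_carrier, of 3 "Suc m" i] block_J_index[OF J0_carrier, of i m 3]
      J0_column_1[of "i - 2" m] by (auto simp: J0_Suc)
qed (use J0_carrier[of "Suc m"] in auto)

lemma skew_scalar_prod:
  fixes J :: "real mat"
  assumes "J \<in> carrier_mat N N" "transpose_mat J = - J" "x \<in> carrier_vec N" "y \<in> carrier_vec N"
  shows "(J *\<^sub>v x) \<bullet> y = - (x \<bullet> (J *\<^sub>v y))"
  using assms by (simp add: scalar_prod_mult_mat_vec[of J N N])

lemma skew_scalar_prod_self:
  fixes J :: "real mat"
  assumes "J \<in> carrier_mat N N" "transpose_mat J = - J" "x \<in> carrier_vec N"
  shows "(J *\<^sub>v x) \<bullet> x = 0"
  using skew_scalar_prod[OF assms assms(3)] comm_scalar_prod[of x N "J *\<^sub>v x"] assms by simp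

text \<open>
  The product of the reflections in \<open>w = x - z\<close> and \<open>J w\<close> is a complex reflection, so it commutes
  with \<open>J\<close>; it maps \<open>x\<close> to \<open>z\<close> because \<open>J w\<close> is orthogonal to \<open>x\<close>.
\<close>

lemma unitary_reflection:
  fixes J :: "real mat"
  assumes J: "J \<in> carrier_mat N N" "transpose_mat J = - J" "J * transpose_mat J = 1\<^sub>m N"
    and x: "x \<in> carrier_vec N" and z: "z \<in> carrier_vec N"
    and xz: "x \<bullet> x = z \<bullet> z" "(J *\<^sub>v x) \<bullet> z = 0"
  shows "\<exists>H\<in>SO_mat N. H * J = J * H \<and> H *\<^sub>v x = z"
proof (cases "x = z")
  case True
  then show ?thesis using x J by (intro bexI[of _ "1\<^sub>m N"]) (auto simp: one_in_SO_mat)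
next
  case False
  have JJ': "transpose_mat J * J = 1\<^sub>m N"
    by (rule mat_mult_left_right_inverse[OF J(1) _ J(3)]) (use J in auto)
  define w where "w = x - z"
  have w: "w \<in> carrier_vec N" using x z by (simp add: w_def)
  have w0: "w \<noteq> 0\<^sub>v N"
  proof
    assume "w = 0\<^sub>v N"
    then have "(x - z) $ i = 0" if "i < N" for i using that by (simp add: w_def)
    then have "x = z" using x z by (intro eq_vecI) auto
    with False show False by simp
  qed
  let ?Jw = "J *\<^sub>v w"
  have Jw: "?Jw \<in> carrier_vec N" using J w by simp
  have "?Jw \<bullet> ?Jw = w \<bullet> w" using scalar_prod_isometry[OF J(1) JJ' w w] .
  then have Jw0: "?Jw \<noteq> 0\<^sub>v N"
    using w0 scalar_prod_self_eq_0[OF w] scalar_prod_self_eq_0[OF Jw] by auto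
  let ?A = "householder w" and ?B = "householder ?Jw"
  have c: "?A \<in> carrier_mat N N" "?B \<in> carrier_mat N N"
    using householder_carrier[OF w] householder_carrier[OF Jw] .
  have "w \<bullet> ?Jw = 0"
    using skew_scalar_prod_self[OF J(1,2) w] comm_scalar_prod[OF w Jw] by simp
  then have fixJw: "?A *\<^sub>v ?Jw = ?Jw" using householder_fix[OF w Jw] by simp
  \<comment> \<open>Conjugation by the reflection in w fixes the reflection in J w, because w is
    orthogonal to J w.\<close>
  have comm: "?B * ?A = ?A * ?B"
    using householder_conj[OF c(1) _ Jw] fixJw householder_square[OF w w0]
    by (simp add: transpose_householder)
  have BJ: "?B * J = J * ?A" by (rule householder_conj[OF J(1) JJ' w])
  \<comment> \<open>Since J (J w) = -w has the same reflection as w, conjugation by J exchanges the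
    two reflections and hence fixes their commuting product.\<close>
  have "J *\<^sub>v ?Jw = (J * J) *\<^sub>v w" using J w by simp
  also have "J * J = - (J * transpose_mat J)"
    unfolding J(2) using J(1) by simp
  also have "\<dots> *\<^sub>v w = (-1) \<cdot>\<^sub>v w"
    unfolding J(3) using w by (intro eq_vecI) auto
  finally have "householder (J *\<^sub>v ?Jw) = ?A" using householder_smult[of "-1" w] by simp
  then have AJ: "?A * J = J * ?B" using householder_conj[OF J(1) JJ' Jw] by simp
  have "(?A * ?B) * J = (?B * ?A) * J" by (simp add: comm)
  also have "\<dots> = ?B * (J * ?B)" using c J by (simp add: AJ assoc_mult_mat[of _ N N _ N _ N])
  also have "\<dots> = (?B * J) * ?B" using c J by (simp add: assoc_mult_mat[of _ N N _ N _ N])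
  also have "\<dots> = J * (?A * ?B)" using c J by (simp add: BJ assoc_mult_mat[of _ N N _ N _ N])
  finally have HJ: "(?A * ?B) * J = J * (?A * ?B)" .
  have Jx: "J *\<^sub>v x \<in> carrier_vec N" "J *\<^sub>v z \<in> carrier_vec N" using J x z by auto
  have "(J *\<^sub>v z) \<bullet> x = - ((J *\<^sub>v x) \<bullet> z)"
    using skew_scalar_prod[OF J(1,2) z x] comm_scalar_prod[OF z Jx(1)] by simp
  \<comment> \<open>J w is J x - J z, and both terms are orthogonal to x: the first by skewness, the
    second by the hypothesis on x and z.\<close>
  then have "?Jw \<bullet> x = 0"
    using J x z Jx xz skew_scalar_prod_self[OF J(1,2) x]
    by (simp add: w_def mult_minus_distrib_mat_vec[of _ N N] minus_scalar_prod_distrib[of _ N])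
  then have "?B *\<^sub>v x = x" by (rule householder_fix[OF Jw x])
  then have "(?A * ?B) *\<^sub>v x = z"
    using c x householder_swap[OF x z xz(1) False] by (simp add: assoc_mult_mat_vec[of _ N N _ N] w_def)
  then show ?thesis using HJ householder_pair_in_SO_mat[OF w w0 Jw Jw0] by blast
qed

text \<open>
  One complex reflection takes \<open>e\<^sub>0\<close> to \<open>u\<close> only if their Hermitian product is real. The detour
  through a unit vector \<open>z\<close> in the complex line of \<open>e\<^sub>2\<close>, chosen so that its Hermitian product
  with \<open>u\<close> is real, works for every \<open>u\<close>.
\<close>

lemma unitary_transitive:
  assumes u: "u \<in> carrier_vec (2 * Suc m + 2)" and uu: "u \<bullet> u = 1"
  shows "\<exists>H\<in>SO_mat (2 * Suc m + 2). H * J0 (Suc m) = J0 (Suc m) * H \<and> H *\<^sub>v unit_vec (2 * Suc m + 2) 0 = u"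
proof -
  let ?N = "2 * Suc m + 2"
  let ?J = "J0 (Suc m)"
  let ?e = "\<lambda>i. unit_vec ?N i :: real vec"
  note J = J0_carrier[of "Suc m"] transpose_J0[of "Suc m"] J0_orthogonal[of "Suc m"]
  \<comment> \<open>For z = c e_2 + d e_3 the second equation says that J z is orthogonal to u. A
    solution is (u_2, u_3) normalised, or any unit pair when both entries vanish.\<close>
  have "\<exists>c d :: real. c * c + d * d = 1 \<and> c * u $ 3 - d * u $ 2 = 0"
  proof (cases "u $ 2 = 0 \<and> u $ 3 = 0")
    case True
    then show ?thesis by (intro exI[of _ 1] exI[of _ 0]) auto
  next
    case False
    define r where "r = sqrt (u $ 2 * u $ 2 + u $ 3 * u $ 3)"
    have p: "u $ 2 * u $ 2 + u $ 3 * u $ 3 > 0"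
      using False sum_squares_gt_zero_iff[of "u $ 2" "u $ 3"] by blast
    then have r: "r > 0" "r * r = u $ 2 * u $ 2 + u $ 3 * u $ 3" by (auto simp: r_def)
    have "u $ 2 / r * (u $ 2 / r) + u $ 3 / r * (u $ 3 / r) = (u $ 2 * u $ 2 + u $ 3 * u $ 3) / (r * r)"
      by (simp add: add_divide_distrib)
    also have "\<dots> = 1" using p unfolding r(2) by (intro divide_self) linarith
    finally have "u $ 2 / r * (u $ 2 / r) + u $ 3 / r * (u $ 3 / r) = 1
        \<and> u $ 2 / r * u $ 3 - u $ 3 / r * u $ 2 = 0" by simp
    then show ?thesis by blast
  qed
  then obtain c d :: real where cd: "c * c + d * d = 1" "c * u $ 3 - d * u $ 2 = 0" by blast
  define z where "z = c \<cdot>\<^sub>v ?e 2 + d \<cdot>\<^sub>v ?e 3"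
  have z: "z \<in> carrier_vec ?N" by (simp add: z_def)
  have zu: "z \<bullet> v = c * v $ 2 + d * v $ 3" if "v \<in> carrier_vec ?N" for v
    using that by (simp add: z_def add_scalar_prod_distrib[of _ ?N])
  have zz: "z \<bullet> z = 1" using zu[OF z] cd(1) by (simp add: z_def)
  have "?J *\<^sub>v z = c \<cdot>\<^sub>v ?e 3 + d \<cdot>\<^sub>v (- ?e 2)"
    using J(1) unfolding z_def J0_mult_unit_2[symmetric] J0_mult_unit_3[symmetric]
    by (simp add: mult_add_distrib_mat_vec[of _ ?N ?N] mult_mat_vec[of _ ?N ?N])
  then have Jz: "(?J *\<^sub>v z) \<bullet> u = 0"
    using u cd(2) by (simp add: add_scalar_prod_distrib[of _ ?N])
  have e0: "?e 0 \<bullet> ?e 0 = z \<bullet> z" by (simp add: zz)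
  \<comment> \<open>J e_0 is e_1, which is orthogonal to the plane of e_2 and e_3 containing
    z.\<close>
  have "(?J *\<^sub>v ?e 0) \<bullet> z = 0"
    using z by (simp add: J0_mult_unit_0[of "Suc m", simplified] z_def)
  then obtain H where H: "H \<in> SO_mat ?N" "H * ?J = ?J * H" "H *\<^sub>v ?e 0 = z"
    using unitary_reflection[OF J _ z e0] by auto
  obtain K where K: "K \<in> SO_mat ?N" "K * ?J = ?J * K" "K *\<^sub>v z = u"
    using unitary_reflection[OF J z u _ Jz] zz uu by auto
  have c: "H \<in> carrier_mat ?N ?N" "K \<in> carrier_mat ?N ?N" using H K by (auto dest: SO_mat_carrier)
  show ?thesis
  proof (intro bexI conjI)
    show "K * H \<in> SO_mat ?N" using H K by (simp add: mult_in_SO_mat)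
    have "K * H * ?J = K * (?J * H)" using c J(1) H(2) by (simp add: assoc_mult_mat[of _ ?N ?N _ ?N _ ?N])
    also have "\<dots> = (?J * K) * H" using c J(1) K(2) by (metis assoc_mult_mat)
    also have "\<dots> = ?J * (K * H)" using c J(1) by (rule_tac assoc_mult_mat)
    finally show "K * H * ?J = ?J * (K * H)" .
    show "K * H *\<^sub>v ?e 0 = u"
      using c H(3) K(3) by (simp add: assoc_mult_mat_vec[of _ ?N ?N _ ?N])
  qed
qed

section \<open>The twistor space\<close>

definition twistor_set :: "nat \<Rightarrow> real mat set" where
  "twistor_set n = {G * J0 n * transpose_mat G | G. G \<in> SO_mat (2 * n + 2)}"

lemma twistor_set_carrier:
  assumes "A \<in> twistor_set n"
  shows "A \<in> carrier_mat (2 * n + 2) (2 * n + 2)"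
  using assms J0_carrier[of n] by (auto simp: twistor_set_def dest!: SO_mat_carrier)

lemma twistor_set_conj:
  assumes "R \<in> SO_mat (2 * n + 2)" "A \<in> twistor_set n"
  shows "R * A * transpose_mat R \<in> twistor_set n"
proof -
  let ?N = "2 * n + 2"
  obtain G where G: "G \<in> SO_mat ?N" "A = G * J0 n * transpose_mat G"
    using assms(2) by (auto simp: twistor_set_def)
  have c: "R \<in> carrier_mat ?N ?N" "G \<in> carrier_mat ?N ?N"
    using assms(1) G by (auto dest: SO_mat_carrier)
  have "R * A * transpose_mat R = (R * G) * J0 n * transpose_mat (R * G)"
    unfolding G(2) using c J0_carrier[of n]
    by (simp add: transpose_mult[of _ ?N ?N] assoc_mult_mat[of _ ?N ?N _ ?N _ ?N])
  then show ?thesis using mult_in_SO_mat[OF assms(1) G(1)] by (auto simp: twistor_set_def)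
qed

lemma twistor_set_skew:
  assumes "A \<in> twistor_set n"
  shows "transpose_mat A = - A"
proof -
  let ?N = "2 * n + 2"
  obtain G where G: "G \<in> SO_mat ?N" "A = G * J0 n * transpose_mat G"
    using assms by (auto simp: twistor_set_def)
  have c: "G \<in> carrier_mat ?N ?N" using G by (auto dest: SO_mat_carrier)
  have "transpose_mat A = G * (transpose_mat (J0 n) * transpose_mat G)"
    unfolding G(2) using c J0_carrier[of n]
    by (simp add: transpose_mult[of _ ?N ?N _ ?N])
  also have "\<dots> = - A"
    unfolding G(2) transpose_J0 using c J0_carrier[of n] by (simp add: assoc_mult_mat[of _ ?N ?N _ ?N _ ?N])
  finally show ?thesis .
qed

lemma twistor_set_orthogonal:
  assumes "A \<in> twistor_set n"
  shows "transpose_mat A * A = 1\<^sub>m (2 * n + 2)"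
proof -
  let ?N = "2 * n + 2"
  obtain G where G: "G \<in> SO_mat ?N" "A = G * J0 n * transpose_mat G"
    using assms by (auto simp: twistor_set_def)
  have c: "G \<in> carrier_mat ?N ?N" "transpose_mat G \<in> carrier_mat ?N ?N"
     "J0 n \<in> carrier_mat ?N ?N" "transpose_mat (J0 n) \<in> carrier_mat ?N ?N"
    using G J0_carrier[of n] by (auto dest: SO_mat_carrier)
  have "transpose_mat A * A = G * (transpose_mat (J0 n) * ((transpose_mat G * G) * (J0 n * transpose_mat G)))"
    unfolding G(2) using c
    by (simp add: transpose_mult[of _ ?N ?N _ ?N] assoc_mult_mat[of _ ?N ?N _ ?N _ ?N])
  also have "\<dots> = G * ((transpose_mat (J0 n) * J0 n) * transpose_mat G)"
    using c G(1) by (simp add: SO_mat_transpose_mult assoc_mult_mat[of _ ?N ?N _ ?N _ ?N])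
  also have "\<dots> = 1\<^sub>m ?N"
    using c G(1) by (simp add: J0_orthogonal' SO_mat_mult_transpose)
  finally show ?thesis .
qed

section \<open>Splitting off the plane of e_0 and e_1\<close>

definition block_one :: "real mat \<Rightarrow> real mat" where
  "block_one B = four_block_mat (1\<^sub>m 2) (0\<^sub>m 2 (dim_col B)) (0\<^sub>m (dim_row B) 2) B"

lemma block_one_carrier: "B \<in> carrier_mat n n \<Longrightarrow> block_one B \<in> carrier_mat (n + 2) (n + 2)"
  by (auto simp: block_one_def)

lemma block_one_mult_transpose:
  assumes "B \<in> carrier_mat n n"
  shows "block_one B * transpose_mat (block_one B) = block_one (B * transpose_mat B)"
proof -
  have "transpose_mat (block_one B) = four_block_mat (1\<^sub>m 2) (0\<^sub>m 2 n) (0\<^sub>m n 2) (transpose_mat B)"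
    unfolding block_one_def using assms by (subst transpose_four_block_mat[of _ 2 2 _ n _ n]) auto
  moreover have "block_one B = four_block_mat (1\<^sub>m 2) (0\<^sub>m 2 n) (0\<^sub>m n 2) B"
    using assms by (simp add: block_one_def)
  ultimately show ?thesis
    using assms by (simp add: block_one_def mult_four_block_mat[of _ 2 2 _ n _ n _ _ 2 _ n])
qed

lemma det_block_one:
  assumes "B \<in> carrier_mat n n"
  shows "Determinant.det (block_one B) = Determinant.det B"
  unfolding block_one_def using assms
  by (subst det_four_block_mat_upper_right_zero[of _ 2 _ n]) auto

text \<open>Both directions matter: one includes the fibre in the next space, the other shows that a
  rotation fixing e_0 and e_1 restricts to a rotation of the complement.\<close>

lemma block_one_in_SO_mat_iff:
  assumes B: "B \<in> carrier_mat n n"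
  shows "block_one B \<in> SO_mat (n + 2) \<longleftrightarrow> B \<in> SO_mat n"
proof -
  have "block_one C = 1\<^sub>m (n + 2) \<longleftrightarrow> C = 1\<^sub>m n" if C: "C \<in> carrier_mat n n" for C
  proof
    assume L: "block_one C = 1\<^sub>m (n + 2)"
    show "C = 1\<^sub>m n"
    proof (rule eq_matI)
      fix i j assume "i < dim_row (1\<^sub>m n :: real mat)" "j < dim_col (1\<^sub>m n :: real mat)"
      then show "C $$ (i, j) = 1\<^sub>m n $$ (i, j)"
        using arg_cong[OF L, of "\<lambda>M. M $$ (i + 2, j + 2)"] C by (simp add: block_one_def)
    qed (use C in auto)
  next
    assume "C = 1\<^sub>m n"
    then show "block_one C = 1\<^sub>m (n + 2)" by (simp add: block_one_def add.commute)
  qed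
  then show ?thesis
    using B block_one_carrier[OF B] by (simp add: SO_mat_def block_one_mult_transpose det_block_one)
qed

lemma block_one_conj_block_J:
  assumes "G \<in> carrier_mat n n" "B \<in> carrier_mat n n"
  shows "block_one G * block_J B * transpose_mat (block_one G) = block_J (G * B * transpose_mat G)"
proof -
  have "transpose_mat (block_one G) = four_block_mat (1\<^sub>m 2) (0\<^sub>m 2 n) (0\<^sub>m n 2) (transpose_mat G)"
    unfolding block_one_def using assms by (subst transpose_four_block_mat[of _ 2 2 _ n _ n]) auto
  moreover have "block_one G = four_block_mat (1\<^sub>m 2) (0\<^sub>m 2 n) (0\<^sub>m n 2) G"
    using assms by (simp add: block_one_def)
  moreover have "block_J B = four_block_mat J1 (0\<^sub>m 2 n) (0\<^sub>m n 2) B"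
    using assms by (simp add: block_J_def)
  ultimately show ?thesis
    using assms J1_carrier by (simp add: block_J_def mult_four_block_mat[of _ 2 2 _ n _ n _ _ 2 _ n])
qed

lemma block_J_in_twistor_set:
  assumes "B \<in> twistor_set n"
  shows "block_J B \<in> twistor_set (Suc n)"
proof -
  obtain G where G: "G \<in> SO_mat (2 * n + 2)" "B = G * J0 n * transpose_mat G"
    using assms by (auto simp: twistor_set_def)
  have c: "G \<in> carrier_mat (2 * n + 2) (2 * n + 2)" using G by (auto dest: SO_mat_carrier)
  have "block_J B = block_one G * J0 (Suc n) * transpose_mat (block_one G)"
    unfolding G(2) J0_Suc block_one_conj_block_J[OF c J0_carrier] ..
  moreover have "block_one G \<in> SO_mat (2 * Suc n + 2)"
    using block_one_in_SO_mat_iff[OF c] G(1) by simp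
  ultimately show ?thesis by (auto simp: twistor_set_def)
qed

text \<open>Equality in Cauchy-Schwarz: a unit vector whose inner product with e_i is 1 differs from
  e_i by a vector of squared length 1 - 1 - 1 + 1 = 0.\<close>

lemma orthogonal_column_unit:
  fixes A :: "real mat"
  assumes A: "A \<in> carrier_mat N N" "transpose_mat A * A = 1\<^sub>m N" and ij: "i < N" "j < N" "A $$ (i, j) = 1"
  shows "A *\<^sub>v unit_vec N j = unit_vec N i"
proof -
  have c: "A *\<^sub>v unit_vec N j \<in> carrier_vec N" using A by simp
  have "(A *\<^sub>v unit_vec N j) \<bullet> (A *\<^sub>v unit_vec N j) = 1"
    using scalar_prod_isometry[OF A, of "unit_vec N j" "unit_vec N j"] ij by simp
  moreover have "(A *\<^sub>v unit_vec N j) \<bullet> unit_vec N i = 1"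
    using ij c mult_mat_vec_unit[OF A(1) ij(2) ij(1)] by simp
  moreover have "unit_vec N i \<bullet> (A *\<^sub>v unit_vec N j) = 1"
    using ij c mult_mat_vec_unit[OF A(1) ij(2) ij(1)] by simp
  ultimately have "(A *\<^sub>v unit_vec N j - unit_vec N i) \<bullet> (A *\<^sub>v unit_vec N j - unit_vec N i) = 0"
    using c ij by (simp add: scalar_prod_minus_distrib[of _ N] minus_scalar_prod_distrib[of _ N])
  then have 0: "A *\<^sub>v unit_vec N j - unit_vec N i = 0\<^sub>v N"
    using c by (subst (asm) scalar_prod_self_eq_0) auto
  show ?thesis
  proof (rule eq_vecI)
    fix k assume "k < dim_vec (unit_vec N i :: real vec)"
    then show "(A *\<^sub>v unit_vec N j) $ k = unit_vec N i $ k"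
      using arg_cong[OF 0, of "\<lambda>v. v $ k"] c by simp
  qed (use A in auto)
qed

text \<open>The first two columns are given; the first two rows follow because the transpose is the
  inverse and so fixes the same vectors.\<close>

lemma SO_mat_eq_block_one:
  assumes G: "G \<in> SO_mat (n + 2)"
    and e: "G *\<^sub>v unit_vec (n + 2) 0 = unit_vec (n + 2) 0" "G *\<^sub>v unit_vec (n + 2) 1 = unit_vec (n + 2) 1"
  shows "\<exists>B\<in>SO_mat n. G = block_one B"
proof -
  let ?N = "n + 2"
  have c: "G \<in> carrier_mat ?N ?N" using G by (rule SO_mat_carrier)
  have fixT: "transpose_mat G *\<^sub>v v = v" if "v \<in> carrier_vec ?N" "G *\<^sub>v v = v" for v
  proof -
    have "transpose_mat G *\<^sub>v v = (transpose_mat G * G) *\<^sub>v v"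
      using that c by (simp add: assoc_mult_mat_vec[of _ ?N ?N _ ?N])
    then show ?thesis using that G by (simp add: SO_mat_transpose_mult)
  qed
  have col: "G $$ (i, j) = (if i = j then 1 else 0)" if "i < ?N" "j < 2" for i j
    using that e mult_mat_vec_unit[OF c, of j i] by (auto simp: less_2_cases_iff)
  have row: "G $$ (j, i) = (if i = j then 1 else 0)" if "i < ?N" "j < 2" for i j
  proof -
    have "G *\<^sub>v unit_vec ?N j = unit_vec ?N j" using that e by (auto simp: less_2_cases_iff)
    then have "transpose_mat G *\<^sub>v unit_vec ?N j = unit_vec ?N j" by (intro fixT) auto
    then show ?thesis
      using that c mult_mat_vec_unit[of "transpose_mat G" ?N ?N j i] by auto
  qed
  define B where "B = mat n n (\<lambda>(i, j). G $$ (i + 2, j + 2))"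
  have B: "B \<in> carrier_mat n n" by (simp add: B_def)
  have "G = block_one B"
  proof (rule eq_matI)
    fix i j assume "i < dim_row (block_one B)" "j < dim_col (block_one B)"
    then have ij: "i < ?N" "j < ?N" using block_one_carrier[OF B] by auto
    show "G $$ (i, j) = block_one B $$ (i, j)"
      using ij col[of i j] row[of j i]
      by (cases "i < 2"; cases "j < 2") (auto simp: block_one_def B_def numeral_2_eq_2 Suc_diff_Suc)
  qed (use c block_one_carrier[OF B] in auto)
  then show ?thesis using G block_one_in_SO_mat_iff[OF B] by auto
qed

text \<open>
  Changing \<open>G\<close> by an element of the unitary group makes it fix \<open>e\<^sub>0\<close>, hence also \<open>e\<^sub>1 = A e\<^sub>0\<close>,
  without leaving \<open>SO\<close>; so no orientation argument is needed to see that \<open>B\<close> lies in the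
  right component.
\<close>

lemma twistor_set_eq_block_J:
  assumes A: "A \<in> twistor_set (Suc n)" and A10: "A $$ (1, 0) = 1"
  shows "\<exists>B\<in>twistor_set n. A = block_J B"
proof -
  let ?N = "2 * Suc n + 2"
  let ?e = "\<lambda>i. unit_vec ?N i :: real vec"
  let ?J = "J0 (Suc n)"
  obtain G where G: "G \<in> SO_mat ?N" "A = G * ?J * transpose_mat G"
    using A by (auto simp: twistor_set_def)
  have cG: "G \<in> carrier_mat ?N ?N" using G by (auto dest: SO_mat_carrier)
  have cJ: "?J \<in> carrier_mat ?N ?N" by (rule J0_carrier)
  \<comment> \<open>A unitary H taking e_0 to this u makes G H fix e_0, while G H still conjugates
    \<open>?J\<close> to A.\<close>
  define u where "u = transpose_mat G *\<^sub>v ?e 0"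
  have u: "u \<in> carrier_vec ?N" using cG by (simp add: u_def)
  have "u \<bullet> u = ?e 0 \<bullet> ?e 0"
    unfolding u_def using cG SO_mat_mult_transpose[OF G(1)]
    by (intro scalar_prod_isometry[of _ ?N]) auto
  then have "u \<bullet> u = 1" by simp
  then obtain H where H: "H \<in> SO_mat ?N" "H * ?J = ?J * H" "H *\<^sub>v ?e 0 = u"
    using unitary_transitive[OF u] by blast
  have cH: "H \<in> carrier_mat ?N ?N" using H by (auto dest: SO_mat_carrier)
  define K where "K = G * H"
  have K: "K \<in> SO_mat ?N" using G H by (simp add: K_def mult_in_SO_mat)
  have cK: "K \<in> carrier_mat ?N ?N" using K by (rule SO_mat_carrier)
  have "K * ?J * transpose_mat K = G * ((H * ?J) * (transpose_mat H * transpose_mat G))"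
    unfolding K_def using cG cH cJ by (simp add: transpose_mult[of _ ?N ?N _ ?N] assoc_mult_mat[of _ ?N ?N _ ?N _ ?N])
  also have "\<dots> = G * (?J * ((H * transpose_mat H) * transpose_mat G))"
    unfolding H(2) using cG cH cJ by (simp add: assoc_mult_mat[of _ ?N ?N _ ?N _ ?N])
  also have "\<dots> = A"
    unfolding G(2) using cG cJ H(1) by (simp add: SO_mat_mult_transpose assoc_mult_mat[of _ ?N ?N _ ?N _ ?N])
  finally have KA: "K * ?J * transpose_mat K = A" .
  have Ke0: "K *\<^sub>v ?e 0 = ?e 0"
  proof -
    have "K *\<^sub>v ?e 0 = (G * transpose_mat G) *\<^sub>v ?e 0"
      using cG cH H(3) by (simp add: K_def u_def assoc_mult_mat_vec[of _ ?N ?N _ ?N])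
    then show ?thesis using G(1) by (simp add: SO_mat_mult_transpose)
  qed
  have KTe0: "transpose_mat K *\<^sub>v ?e 0 = ?e 0"
  proof -
    have "transpose_mat K *\<^sub>v (K *\<^sub>v ?e 0) = (transpose_mat K * K) *\<^sub>v ?e 0"
      using cK by (simp add: assoc_mult_mat_vec[of _ ?N ?N _ ?N])
    then show ?thesis using K Ke0 by (simp add: SO_mat_transpose_mult)
  qed
  \<comment> \<open>Both K and its transpose fix e_0, so K e_1 = K J e_0 = K J K^t e_0 = A e_0, and
    the entry 1 forces this unit vector to be e_1.\<close>
  have "K *\<^sub>v ?e 1 = K *\<^sub>v (?J *\<^sub>v (transpose_mat K *\<^sub>v ?e 0))"
    unfolding KTe0 J0_mult_unit_0 ..
  also have "\<dots> = A *\<^sub>v ?e 0"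
    unfolding KA[symmetric] using cK cJ
    by (simp add: assoc_mult_mat_vec[of _ ?N ?N _ ?N])
  also have "\<dots> = ?e 1"
    using twistor_set_carrier[OF A] twistor_set_orthogonal[OF A] A10
    by (intro orthogonal_column_unit) auto
  finally have Ke1: "K *\<^sub>v ?e 1 = ?e 1" .
  obtain M where M: "M \<in> SO_mat (2 * n + 2)" "K = block_one M"
    using SO_mat_eq_block_one[of K "2 * n + 2"] K Ke0 Ke1 by auto
  have "A = block_J (M * J0 n * transpose_mat M)"
    unfolding KA[symmetric] J0_Suc M(2)
    by (rule block_one_conj_block_J[OF SO_mat_carrier[OF M(1)] J0_carrier])
  then show ?thesis using M(1) by (auto simp: twistor_set_def)
qed

lemma det_mat_2:
  fixes A :: "real mat"
  assumes A: "A \<in> carrier_mat 2 2"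
  shows "Determinant.det A = A $$ (0, 0) * A $$ (1, 1) - A $$ (0, 1) * A $$ (1, 0)"
proof -
  have "Determinant.det A = (\<Sum>i<2. A $$ (i, 0) * cofactor A i 0)"
    using A by (intro laplace_expansion_column) auto
  moreover have "Determinant.det (mat_delete A i 0) = A $$ (1 - i, 1)" if "i < 2" for i
  proof -
    have "mat_delete A i 0 \<in> carrier_mat 1 1" using A that mat_delete_carrier[of A 2 2 i 0] by simp
    then have "Determinant.det (mat_delete A i 0) = mat_delete A i 0 $$ (0, 0)" by (rule det_single)
    also have "\<dots> = A $$ (1 - i, 1)"
      using A that by (auto simp: mat_delete_def less_Suc_eq numeral_2_eq_2)
    finally show ?thesis .
  qed
  ultimately show ?thesis by (simp add: cofactor_def numeral_2_eq_2)
qed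

text \<open>In size 2 one has G J1 G^t = det(G) J1, so the induction starts from a single
  point.\<close>

lemma twistor_set_0: "twistor_set 0 = {J0 0}"
proof -
  have "A = J1" if A: "A \<in> twistor_set 0" for A
  proof -
    obtain G where G: "G \<in> SO_mat 2" "A = G * J1 * transpose_mat G"
      using A by (auto simp: twistor_set_def J0_0 numeral_2_eq_2)
    have c: "G \<in> carrier_mat 2 2" using G by (auto dest: SO_mat_carrier)
    have d: "G $$ (0, 0) * G $$ (1, 1) - G $$ (0, 1) * G $$ (1, 0) = 1"
      using G(1) det_mat_2[OF c] by (simp add: SO_mat_def)
    show ?thesis
    proof (rule eq_matI)
      fix i j assume "i < dim_row J1" "j < dim_col J1"
      then have "i < 2" "j < 2" using J1_carrier by auto
      then show "A $$ (i, j) = J1 $$ (i, j)"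
        using c J1_carrier d unfolding G(2)
        by (auto simp: less_Suc_eq J1_index scalar_prod_def numeral_2_eq_2 algebra_simps)
    qed (use c J1_carrier G in auto)
  qed
  moreover have "J0 0 \<in> twistor_set 0"
    using one_in_SO_mat[of 2] J1_carrier
    by (auto simp: twistor_set_def J0_0 numeral_2_eq_2 intro!: exI[of _ "1\<^sub>m 2"])
  ultimately show ?thesis by (auto simp: J0_0)
qed

section \<open>Continuity of matrix-valued maps, entry by entry\<close>

lemma topspace_matrix_topology: "topspace (matrix_topology m n) = carrier_mat m n"
  by (auto simp: matrix_topology_def topspace_pullback_topology)

lemma continuous_map_matrix_topology_iff:
  "continuous_map T (matrix_topology m n) f \<longleftrightarrow>
     (\<forall>x\<in>topspace T. f x \<in> carrier_mat m n) \<and>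
     (\<forall>i<m. \<forall>j<n. continuous_map T euclideanreal (\<lambda>x. f x $$ (i, j)))"
proof
  assume L: "continuous_map T (matrix_topology m n) f"
  show "(\<forall>x\<in>topspace T. f x \<in> carrier_mat m n) \<and>
     (\<forall>i<m. \<forall>j<n. continuous_map T euclideanreal (\<lambda>x. f x $$ (i, j)))"
  proof (intro conjI ballI allI impI)
    show "f x \<in> carrier_mat m n" if "x \<in> topspace T" for x
      using continuous_map_image_subset_topspace[OF L] that by (auto simp: topspace_matrix_topology)
    fix i j assume ij: "i < m" "j < n"
    let ?g = "\<lambda>A::real mat. restrict (\<lambda>ij. A $$ ij) ({..<m} \<times> {..<n})"
    have "continuous_map (matrix_topology m n) (product_topology (\<lambda>_. euclideanreal) ({..<m} \<times> {..<n})) (id \<circ> ?g)"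
      unfolding matrix_topology_def by (rule continuous_map_pullback[OF continuous_map_id])
    then have "continuous_map (matrix_topology m n) euclideanreal (\<lambda>A. ?g A (i, j))"
      using ij by (auto simp: continuous_map_componentwise)
    then have "continuous_map (matrix_topology m n) euclideanreal (\<lambda>A. A $$ (i, j))"
      using ij by simp
    from continuous_map_compose[OF L this]
    show "continuous_map T euclideanreal (\<lambda>x. f x $$ (i, j))" by (simp add: o_def)
  qed
next
  assume R: "(\<forall>x\<in>topspace T. f x \<in> carrier_mat m n) \<and>
     (\<forall>i<m. \<forall>j<n. continuous_map T euclideanreal (\<lambda>x. f x $$ (i, j)))"
  show "continuous_map T (matrix_topology m n) f"
    unfolding matrix_topology_def
  proof (rule continuous_map_pullback')
    show "topspace T \<subseteq> f -` carrier_mat m n" using R by auto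
    show "continuous_map T (product_topology (\<lambda>_. euclideanreal) ({..<m} \<times> {..<n}))
        ((\<lambda>A. restrict (\<lambda>ij. A $$ ij) ({..<m} \<times> {..<n})) \<circ> f)"
      using R by (auto simp: continuous_map_componentwise)
  qed
qed

lemma continuous_map_mat_mult:
  assumes "continuous_map T (matrix_topology m k) f" "continuous_map T (matrix_topology k n) g"
  shows "continuous_map T (matrix_topology m n) (\<lambda>x. f x * g x)"
  unfolding continuous_map_matrix_topology_iff
proof (intro conjI ballI allI impI)
  note f = assms(1)[unfolded continuous_map_matrix_topology_iff]
  note g = assms(2)[unfolded continuous_map_matrix_topology_iff]
  show "f x * g x \<in> carrier_mat m n" if "x \<in> topspace T" for x
    using f g that by auto
  fix i j assume ij: "i < m" "j < n"
  show "continuous_map T euclideanreal (\<lambda>x. (f x * g x) $$ (i, j))"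
  proof (rule continuous_map_eq)
    show "continuous_map T euclideanreal (\<lambda>x. \<Sum>l\<in>{0..<k}. f x $$ (i, l) * g x $$ (l, j))"
      using f g ij by (intro continuous_map_sum continuous_map_real_mult) auto
    show "(\<Sum>l\<in>{0..<k}. f x $$ (i, l) * g x $$ (l, j)) = (f x * g x) $$ (i, j)" if "x \<in> topspace T" for x
    proof -
      have "f x \<in> carrier_mat m k" "g x \<in> carrier_mat k n" using f g that by auto
      then show ?thesis using ij by (auto simp: scalar_prod_def)
    qed
  qed
qed

lemma continuous_map_mat_transpose:
  assumes "continuous_map T (matrix_topology m n) f"
  shows "continuous_map T (matrix_topology n m) (\<lambda>x. transpose_mat (f x))"
  unfolding continuous_map_matrix_topology_iff
proof (intro conjI ballI allI impI)
  note f = assms(1)[unfolded continuous_map_matrix_topology_iff]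
  show "transpose_mat (f x) \<in> carrier_mat n m" if "x \<in> topspace T" for x
    using f that by auto
  fix i j assume ij: "i < n" "j < m"
  show "continuous_map T euclideanreal (\<lambda>x. transpose_mat (f x) $$ (i, j))"
  proof (rule continuous_map_eq)
    show "continuous_map T euclideanreal (\<lambda>x. f x $$ (j, i))" using f ij by auto
    show "f x $$ (j, i) = transpose_mat (f x) $$ (i, j)" if "x \<in> topspace T" for x
    proof -
      have "f x \<in> carrier_mat m n" using f that by auto
      then show ?thesis using ij by auto
    qed
  qed
qed

lemma twistor_space_eq: "twistor_space n = subtopology (matrix_topology (2 * n + 2) (2 * n + 2)) (twistor_set n)"
  by (simp add: twistor_space_def twistor_set_def)

lemma topspace_twistor_space: "topspace (twistor_space n) = twistor_set n"
  using twistor_set_carrier by (auto simp: twistor_space_eq topspace_matrix_topology)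

lemma continuous_map_twistor_space_iff:
  "continuous_map T (twistor_space n) f \<longleftrightarrow>
     continuous_map T (matrix_topology (2 * n + 2) (2 * n + 2)) f \<and> f \<in> topspace T \<rightarrow> twistor_set n"
  by (simp add: twistor_space_eq continuous_map_in_subtopology image_subset_iff_funcset)

lemma continuous_map_from_twistor_space:
  "continuous_map (subtopology (twistor_space n) U) (matrix_topology (2 * n + 2) (2 * n + 2)) (\<lambda>A. A)"
  using continuous_map_id_subt[of "matrix_topology (2 * n + 2) (2 * n + 2)" "twistor_set n \<inter> U"]
  by (simp add: twistor_space_eq subtopology_subtopology id_def)

lemma continuous_map_twistor_entry:
  assumes "i < 2 * n + 2" "j < 2 * n + 2"
  shows "continuous_map (subtopology (twistor_space n) U) euclideanreal (\<lambda>A. A $$ (i, j))"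
  using continuous_map_from_twistor_space[of n U] assms by (simp add: continuous_map_matrix_topology_iff)

section \<open>A chart over the punctured sphere\<close>

text \<open>
  With \<open>y = (0, 1, s)\<close>, the rotation \<open>rot N s\<close> fixes \<open>e\<^sub>0\<close> and takes \<open>e\<^sub>1\<close> to the point of the sphere
  with stereographic coordinate \<open>s\<close>, seen from \<open>- e\<^sub>1\<close>.
\<close>

definition stereo_vec :: "nat \<Rightarrow> (nat \<Rightarrow> real) \<Rightarrow> real vec" where
  "stereo_vec N s = vec (N + 2) (\<lambda>i. if i = 0 then 0 else if i = 1 then 1 else s (i - 2))"

definition rot :: "nat \<Rightarrow> (nat \<Rightarrow> real) \<Rightarrow> real mat" where
  "rot N s = householder (stereo_vec N s) * householder (unit_vec (N + 2) 1)"

lemma stereo_vec_carrier: "stereo_vec N s \<in> carrier_vec (N + 2)"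
  by (simp add: stereo_vec_def)

lemma stereo_vec_norm: "stereo_vec N s \<bullet> stereo_vec N s = 1 + (\<Sum>i<N. s i * s i)"
proof -
  have "stereo_vec N s \<bullet> stereo_vec N s
      = (\<Sum>i<Suc (Suc N). stereo_vec N s $ i * stereo_vec N s $ i)"
    by (simp add: scalar_prod_def atLeast0LessThan stereo_vec_def)
  also have "\<dots> = 1 + (\<Sum>i<N. stereo_vec N s $ (Suc (Suc i)) * stereo_vec N s $ (Suc (Suc i)))"
    unfolding sum.lessThan_Suc_shift by (simp add: stereo_vec_def)
  also have "\<dots> = 1 + (\<Sum>i<N. s i * s i)" by (simp add: stereo_vec_def)
  finally show ?thesis .
qed

lemma stereo_vec_norm_pos: "1 + (\<Sum>i<N. s i * s i) > (0 :: real)"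
  by (intro add_pos_nonneg sum_nonneg) auto

lemma stereo_vec_nonzero: "stereo_vec N s \<noteq> 0\<^sub>v (N + 2)"
  using stereo_vec_norm[of N s] stereo_vec_norm_pos[where N = N and s = s] by auto

lemma unit_vec_nonzero: "i < N \<Longrightarrow> unit_vec N i \<noteq> (0\<^sub>v N :: real vec)"
  by (auto dest: arg_cong[of _ _ "\<lambda>v. v $ i"])

lemma rot_in_SO_mat: "rot N s \<in> SO_mat (N + 2)"
  unfolding rot_def
  by (intro householder_pair_in_SO_mat stereo_vec_carrier stereo_vec_nonzero unit_vec_nonzero) auto

lemma rot_carrier: "rot N s \<in> carrier_mat (N + 2) (N + 2)"
  by (rule SO_mat_carrier[OF rot_in_SO_mat])

lemma rot_mult_unit_0: "rot N s *\<^sub>v unit_vec (N + 2) 0 = unit_vec (N + 2) 0"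
proof -
  have c: "householder (stereo_vec N s) \<in> carrier_mat (N + 2) (N + 2)"
      "householder (unit_vec (N + 2) 1) \<in> carrier_mat (N + 2) (N + 2)"
    by (intro householder_carrier stereo_vec_carrier unit_vec_carrier)+
  have "householder (unit_vec (N + 2) 1) *\<^sub>v unit_vec (N + 2) 0 = unit_vec (N + 2) 0"
    by (rule householder_fix[of _ "N + 2"]) auto
  moreover have "stereo_vec N s \<bullet> unit_vec (N + 2) 0 = 0"
    by (subst scalar_prod_right_unit) (auto simp: stereo_vec_def)
  then have "householder (stereo_vec N s) *\<^sub>v unit_vec (N + 2) 0 = unit_vec (N + 2) 0"
    by (intro householder_fix[OF stereo_vec_carrier]) auto
  ultimately show ?thesis
    using c by (simp add: rot_def assoc_mult_mat_vec[of _ "N + 2" "N + 2" _ "N + 2"])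
qed

text \<open>The first reflection sends e_1 to -e_1, the second is the one defined by y = (0, 1, s).
  The result is the other point where the line through -e_1 in direction y meets the sphere, that
  is, inverse stereographic projection.\<close>

lemma rot_mult_unit_1:
  "rot N s *\<^sub>v unit_vec (N + 2) 1 = (2 / (1 + (\<Sum>i<N. s i * s i))) \<cdot>\<^sub>v stereo_vec N s - unit_vec (N + 2) 1"
proof -
  let ?e = "unit_vec (N + 2) 1 :: real vec"
  have c: "householder (stereo_vec N s) \<in> carrier_mat (N + 2) (N + 2)"
      "householder ?e \<in> carrier_mat (N + 2) (N + 2)"
    by (intro householder_carrier stereo_vec_carrier unit_vec_carrier)+
  have "householder ?e *\<^sub>v ?e = ?e - 2 \<cdot>\<^sub>v ?e"
    by (simp add: householder_mult_vec[of _ "N + 2"])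
  also have "\<dots> = (-1) \<cdot>\<^sub>v ?e" by (intro eq_vecI) auto
  finally have 1: "householder ?e *\<^sub>v ?e = (-1) \<cdot>\<^sub>v ?e" .
  have e: "stereo_vec N s \<bullet> ?e = 1"
    by (subst scalar_prod_right_unit) (auto simp: stereo_vec_def)
  have "rot N s *\<^sub>v ?e = (-1) \<cdot>\<^sub>v (householder (stereo_vec N s) *\<^sub>v ?e)"
    unfolding rot_def using c 1
    by (simp add: assoc_mult_mat_vec[of _ "N + 2" "N + 2" _ "N + 2"] mult_mat_vec[of _ "N + 2" "N + 2"])
  also have "\<dots> = (2 / (1 + (\<Sum>i<N. s i * s i))) \<cdot>\<^sub>v stereo_vec N s - ?e"
    unfolding householder_mult_vec[OF stereo_vec_carrier unit_vec_carrier] e stereo_vec_norm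
    using stereo_vec_carrier[of N s] by (intro eq_vecI) auto
  finally show ?thesis .
qed

lemma rot_mult_unit_1_index:
  assumes "i < N"
  shows "(rot N s *\<^sub>v unit_vec (N + 2) 1) $ (i + 2) = 2 / (1 + (\<Sum>i<N. s i * s i)) * s i"
    and "(rot N s *\<^sub>v unit_vec (N + 2) 1) $ 0 = 0"
    and "(rot N s *\<^sub>v unit_vec (N + 2) 1) $ 1 = 2 / (1 + (\<Sum>i<N. s i * s i)) - 1"
  using assms unfolding rot_mult_unit_1 by (auto simp: stereo_vec_def)

lemma transpose_fix_unit:
  assumes "R \<in> SO_mat N" "x \<in> carrier_vec N" "y \<in> carrier_vec N" "R *\<^sub>v x = y"
  shows "transpose_mat R *\<^sub>v y = x"
proof -
  have c: "R \<in> carrier_mat N N" using assms(1) by (rule SO_mat_carrier)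
  have "transpose_mat R *\<^sub>v (R *\<^sub>v x) = (transpose_mat R * R) *\<^sub>v x"
    using c assms by (simp add: assoc_mult_mat_vec[of _ N N _ N])
  then show ?thesis using assms by (simp add: SO_mat_transpose_mult)
qed

lemma conj_mult_unit:
  assumes R: "R \<in> SO_mat N" and A: "A \<in> carrier_mat N N" and "x \<in> carrier_vec N" "R *\<^sub>v x = x"
  shows "R * A * transpose_mat R *\<^sub>v x = R *\<^sub>v (A *\<^sub>v x)"
proof -
  have c: "R \<in> carrier_mat N N" using R by (rule SO_mat_carrier)
  show ?thesis
    using transpose_fix_unit[OF R assms(3) assms(3) assms(4)] c A assms(3)
    by (simp add: assoc_mult_mat_vec[of _ N N _ N])
qed

lemma block_J_mult_unit_0:
  assumes "B \<in> carrier_mat n n"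
  shows "block_J B *\<^sub>v unit_vec (n + 2) 0 = unit_vec (n + 2) 1"
proof (rule eq_vecI)
  fix i assume "i < dim_vec (unit_vec (n + 2) 1 :: real vec)"
  then show "(block_J B *\<^sub>v unit_vec (n + 2) 0) $ i = unit_vec (n + 2) 1 $ i"
    using mult_mat_vec_unit[OF block_J_carrier[OF assms], of 0 i] block_J_index[OF assms, of i 0]
    by (auto simp: J1_index less_2_cases_iff)
qed (use block_J_carrier[OF assms] in auto)

definition chart :: "nat \<Rightarrow> (nat \<Rightarrow> real) \<times> real mat \<Rightarrow> real mat" where
  "chart N z = rot N (fst z) * block_J (snd z) * transpose_mat (rot N (fst z))"

text \<open>Stereographic projection from -e_1 of the first column. Points of
  \<open>Euclidean_space N\<close> must vanish from coordinate N on, hence the value 0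
  there.\<close>

definition stereo_coord :: "nat \<Rightarrow> real mat \<Rightarrow> nat \<Rightarrow> real" where
  "stereo_coord N A = (\<lambda>i. if i < N then A $$ (i + 2, 0) / (1 + A $$ (1, 0)) else 0)"

definition lower_block :: "nat \<Rightarrow> real mat \<Rightarrow> real mat" where
  "lower_block N A = mat N N (\<lambda>(i, j). A $$ (i + 2, j + 2))"

definition chart_inv :: "nat \<Rightarrow> real mat \<Rightarrow> (nat \<Rightarrow> real) \<times> real mat" where
  "chart_inv N A = (stereo_coord N A,
     lower_block N (transpose_mat (rot N (stereo_coord N A)) * A * rot N (stereo_coord N A)))"

lemma lower_block_block_J: "B \<in> carrier_mat N N \<Longrightarrow> lower_block N (block_J B) = B"
  by (rule eq_matI) (auto simp: lower_block_def block_J_index)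

text \<open>The rotation fixes e_0 and \<open>block_J B\<close> sends e_0 to e_1, so the first
  column is the base point and depends on s alone.\<close>

lemma chart_column:
  assumes "B \<in> carrier_mat N N" "i < N + 2"
  shows "chart N (s, B) $$ (i, 0) = (rot N s *\<^sub>v unit_vec (N + 2) 1) $ i"
proof -
  have "rot N s * block_J B \<in> carrier_mat (N + 2) (N + 2)"
    using rot_carrier block_J_carrier[OF assms(1)] by (rule mult_carrier_mat)
  then have c: "chart N (s, B) \<in> carrier_mat (N + 2) (N + 2)"
    unfolding chart_def fst_conv snd_conv
    by (rule mult_carrier_mat) (rule transpose_carrier_mat[THEN iffD2], rule rot_carrier)
  have "chart N (s, B) $$ (i, 0) = (chart N (s, B) *\<^sub>v unit_vec (N + 2) 0) $ i"
    by (rule mult_mat_vec_unit[OF c _ assms(2), symmetric]) simp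
  also have "chart N (s, B) *\<^sub>v unit_vec (N + 2) 0 = rot N s *\<^sub>v unit_vec (N + 2) 1"
    unfolding chart_def fst_conv snd_conv
      conj_mult_unit[OF rot_in_SO_mat block_J_carrier[OF assms(1)] unit_vec_carrier rot_mult_unit_0]
      block_J_mult_unit_0[OF assms(1)] ..
  finally show ?thesis .
qed

lemma chart_entry_10:
  assumes "B \<in> carrier_mat N N" "N > 0"
  shows "chart N (s, B) $$ (1, 0) = 2 / (1 + (\<Sum>i<N. s i * s i)) - 1"
  using chart_column[OF assms(1), of 1] rot_mult_unit_1_index(3)[OF assms(2)] by simp

lemma chart_inv_chart:
  assumes B: "B \<in> carrier_mat N N" and N: "N > 0" and s: "\<forall>i\<ge>N. s i = 0"
  shows "chart_inv N (chart N (s, B)) = (s, B)"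
proof -
  let ?q = "1 + (\<Sum>i<N. s i * s i)"
  let ?R = "rot N s"
  have q: "?q > 0" by (rule stereo_vec_norm_pos)
  \<comment> \<open>This equals 1 plus the entry (1, 0), the denominator in
    \<open>stereo_coord\<close>; it is also the factor of s in the rest of the column, so the two
    cancel.\<close>
  define c where "c = 2 / ?q"
  have c0: "c \<noteq> 0" using q by (simp add: c_def)
  have col: "chart N (s, B) $$ (i + 2, 0) = c * s i" if "i < N" for i
    unfolding c_def rot_mult_unit_1_index(1)[OF that, symmetric] using that
    by (intro chart_column[OF B]) simp
  have "1 + chart N (s, B) $$ (1, 0) = c"
    unfolding c_def chart_entry_10[OF B N] by simp
  then have sc: "stereo_coord N (chart N (s, B)) = s"
    unfolding stereo_coord_def using s c0 col by (intro ext) (simp del: add_2_eq_Suc')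
  have c: "?R \<in> carrier_mat (N + 2) (N + 2)" "block_J B \<in> carrier_mat (N + 2) (N + 2)"
    using rot_carrier block_J_carrier[OF B] by auto
  have "transpose_mat ?R * chart N (s, B) * ?R
     = (transpose_mat ?R * ?R) * (block_J B * (transpose_mat ?R * ?R))"
    unfolding chart_def fst_conv snd_conv using c
    by (simp add: assoc_mult_mat[of _ "N + 2" "N + 2" _ "N + 2" _ "N + 2"])
  also have "\<dots> = block_J B" using c SO_mat_transpose_mult[OF rot_in_SO_mat] by simp
  finally show ?thesis
    using sc B by (simp add: chart_inv_def lower_block_block_J)
qed

lemma chart_in_twistor_set:
  assumes "B \<in> twistor_set n"
  shows "chart (2 * n + 2) (s, B) \<in> twistor_set (Suc n)"
  unfolding chart_def fst_conv snd_conv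
  by (rule twistor_set_conj[OF _ block_J_in_twistor_set[OF assms]])
    (use rot_in_SO_mat[of "2 * n + 2" s] in simp)

text \<open>Skewness kills the diagonal entry and orthogonality gives the column length 1.\<close>

lemma twistor_set_column_norm:
  assumes "A \<in> twistor_set (Suc n)"
  shows "A $$ (0, 0) = 0"
    and "A $$ (1, 0) * A $$ (1, 0) + (\<Sum>i<2 * n + 2. A $$ (i + 2, 0) * A $$ (i + 2, 0)) = 1"
proof -
  let ?M = "2 * Suc n + 2"
  have c: "A \<in> carrier_mat ?M ?M" by (rule twistor_set_carrier[OF assms])
  show 0: "A $$ (0, 0) = 0"
    using arg_cong[OF twistor_set_skew[OF assms], of "\<lambda>M. M $$ (0, 0)"] c by simp
  have "1 = (transpose_mat A * A) $$ (0, 0)"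
    unfolding twistor_set_orthogonal[OF assms] by simp
  also have "\<dots> = (\<Sum>i<Suc (Suc (2 * n + 2)). A $$ (i, 0) * A $$ (i, 0))"
    using c by (simp add: scalar_prod_def atLeast0LessThan)
  also have "\<dots> = A $$ (1, 0) * A $$ (1, 0) + (\<Sum>i<2 * n + 2. A $$ (i + 2, 0) * A $$ (i + 2, 0))"
    unfolding sum.lessThan_Suc_shift using 0 by simp
  finally show "A $$ (1, 0) * A $$ (1, 0) + (\<Sum>i<2 * n + 2. A $$ (i + 2, 0) * A $$ (i + 2, 0)) = 1" by simp
qed

lemma twistor_entry_10_bounds:
  assumes "A \<in> twistor_set (Suc n)"
  shows "-1 \<le> A $$ (1, 0)" "A $$ (1, 0) \<le> 1"
proof -
  have "(\<Sum>i<2 * n + 2. A $$ (i + 2, 0) * A $$ (i + 2, 0)) \<ge> 0" by (intro sum_nonneg) auto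
  then have "(A $$ (1, 0))\<^sup>2 \<le> 1"
    using twistor_set_column_norm(2)[OF assms] by (simp add: power2_eq_square)
  then show "-1 \<le> A $$ (1, 0)" "A $$ (1, 0) \<le> 1" by (auto simp: abs_square_le_1 abs_le_iff)
qed

text \<open>Rotating back turns A into a matrix that sends e_0 to e_1. Such a matrix is
  \<open>block_J B\<close> with B in the right component, by
  \<open>twistor_set_eq_block_J\<close>.\<close>

lemma chart_chart_inv:
  assumes A: "A \<in> twistor_set (Suc n)" and A10: "A $$ (1, 0) \<noteq> -1"
  shows "snd (chart_inv (2 * n + 2) A) \<in> twistor_set n"
    and "chart (2 * n + 2) (chart_inv (2 * n + 2) A) = A"
proof -
  let ?N = "2 * n + 2"
  let ?M = "?N + 2"
  define s where "s = stereo_coord ?N A"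
  define a where "a = A $$ (1, 0)"
  let ?R = "rot ?N s"
  have a: "1 + a > 0" using twistor_entry_10_bounds[OF A] A10 by (simp add: a_def)
  have cA: "A \<in> carrier_mat ?M ?M" using twistor_set_carrier[OF A] by simp
  have cR: "?R \<in> carrier_mat ?M ?M" by (rule rot_carrier)
  \<comment> \<open>With a the entry (1, 0), the sphere equation gives |s|^2 = (1 - a^2) / (1 + a)^2
    = (1 - a) / (1 + a), so the factor 2 / (1 + |s|^2) of the rotation is 1 + a.\<close>
  have "(\<Sum>i<?N. s i * s i) = (\<Sum>i<?N. A $$ (i + 2, 0) * A $$ (i + 2, 0) / ((1 + a) * (1 + a)))"
    by (intro sum.cong) (auto simp: s_def stereo_coord_def a_def)
  also have "\<dots> = (1 - a * a) / ((1 + a) * (1 + a))"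
    using twistor_set_column_norm(2)[OF A] unfolding sum_divide_distrib[symmetric] a_def by (simp add: algebra_simps)
  also have "\<dots> = ((1 - a) * (1 + a)) / ((1 + a) * (1 + a))" by (simp add: algebra_simps)
  also have "\<dots> = (1 - a) / (1 + a)" using a by simp
  finally have "1 + (\<Sum>i<?N. s i * s i) = 2 / (1 + a)" using a by (simp add: field_simps)
  then have q: "2 / (1 + (\<Sum>i<?N. s i * s i)) = 1 + a" using a by simp
  have Re1: "?R *\<^sub>v unit_vec ?M 1 = A *\<^sub>v unit_vec ?M 0"
  proof (rule eq_vecI)
    fix i assume "i < dim_vec (A *\<^sub>v unit_vec ?M 0)"
    then have i: "i < ?M" using cA by simp
    then have Ai: "(A *\<^sub>v unit_vec ?M 0) $ i = A $$ (i, 0)" by (intro mult_mat_vec_unit[OF cA]) auto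
    note ri = rot_mult_unit_1_index[where N = ?N and s = s, unfolded q]
    consider "i = 0" | "i = 1" | j where "i = j + 2" "j < ?N"
    proof (cases "i < 2")
      case False
      then show ?thesis using that(3)[of "i - 2"] i by auto
    qed (use that(1,2) in \<open>auto simp: less_2_cases_iff\<close>)
    then show "(?R *\<^sub>v unit_vec ?M 1) $ i = (A *\<^sub>v unit_vec ?M 0) $ i"
    proof cases
      case 1
      then show ?thesis using Ai ri(2)[of 0] twistor_set_column_norm(1)[OF A] by simp
    next
      case 2
      then show ?thesis using Ai ri(3)[of 0] by (simp add: a_def)
    next
      case 3
      then show ?thesis using Ai ri(1)[of j] a by (simp add: s_def stereo_coord_def a_def)
    qed
  qed (use cA cR in auto)
  define B' where "B' = transpose_mat ?R * A * ?R"
  have B': "B' \<in> twistor_set (Suc n)"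
    using twistor_set_conj[of "transpose_mat ?R" "Suc n" A] transpose_in_SO_mat[OF rot_in_SO_mat] A
    by (simp add: B'_def)
  have "B' *\<^sub>v unit_vec ?M 0 = transpose_mat ?R *\<^sub>v (A *\<^sub>v unit_vec ?M 0)"
    using cA cR by (simp add: B'_def assoc_mult_mat_vec[of _ ?M ?M _ ?M] rot_mult_unit_0[of ?N s, simplified])
  also have "\<dots> = unit_vec ?M 1"
    by (rule transpose_fix_unit[OF rot_in_SO_mat _ _ Re1]) (use cA in auto)
  finally have B'e0: "B' *\<^sub>v unit_vec ?M 0 = unit_vec ?M 1" .
  have cB': "B' \<in> carrier_mat ?M ?M" using twistor_set_carrier[OF B'] by simp
  have "B' $$ (1, 0) = (B' *\<^sub>v unit_vec ?M 0) $ 1"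
    by (rule mult_mat_vec_unit[OF cB', symmetric]) auto
  then have B'10: "B' $$ (1, 0) = 1" unfolding B'e0 by simp
  obtain B where B: "B \<in> twistor_set n" "B' = block_J B"
    by (rule bexE[OF twistor_set_eq_block_J[OF B' B'10]])
  have ci: "chart_inv ?N A = (s, B)"
    unfolding chart_inv_def s_def[symmetric] B'_def[symmetric] B(2)
    using lower_block_block_J[OF twistor_set_carrier[OF B(1)]] by simp
  then show "snd (chart_inv ?N A) \<in> twistor_set n" using B by simp
  have "chart ?N (s, B) = (?R * transpose_mat ?R) * (A * (?R * transpose_mat ?R))"
    unfolding chart_def fst_conv snd_conv B(2)[symmetric] B'_def
    using cA cR by (simp add: assoc_mult_mat[of _ ?M ?M _ ?M _ ?M])
  also have "\<dots> = A" using cA SO_mat_mult_transpose[OF rot_in_SO_mat[of ?N s]] by simp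
  finally show "chart ?N (chart_inv ?N A) = A" unfolding ci .
qed

lemma continuous_map_householder_stereo:
  assumes "\<And>i. continuous_map T euclideanreal (\<lambda>x. s x i)"
  shows "continuous_map T (matrix_topology (N + 2) (N + 2)) (\<lambda>x. householder (stereo_vec N (s x)))"
  unfolding continuous_map_matrix_topology_iff
proof (intro conjI ballI allI impI)
  show "householder (stereo_vec N (s x)) \<in> carrier_mat (N + 2) (N + 2)" for x
    by (intro householder_carrier stereo_vec_carrier)
  fix i j assume ij: "i < N + 2" "j < N + 2"
  have y: "continuous_map T euclideanreal (\<lambda>x. stereo_vec N (s x) $ k)" if "k < N + 2" for k
    using that assms by (simp add: stereo_vec_def)
  have "continuous_map T euclideanreal (\<lambda>x. (if i = j then 1 else 0)
      - 2 * stereo_vec N (s x) $ i * stereo_vec N (s x) $ j / (1 + (\<Sum>k<N. s x k * s x k)))"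
    using stereo_vec_norm_pos[where N = N]
    by (intro continuous_intros y ij assms) (auto simp: less_imp_neq[THEN not_sym])
  moreover have "householder (stereo_vec N t) $$ (i, j) = (if i = j then 1 else 0)
      - 2 * stereo_vec N t $ i * stereo_vec N t $ j / (1 + (\<Sum>k<N. t k * t k))" for t
    using ij carrier_vecD[OF stereo_vec_carrier[of N t]] by (simp add: householder_def stereo_vec_norm)
  ultimately show "continuous_map T euclideanreal (\<lambda>x. householder (stereo_vec N (s x)) $$ (i, j))"
    by simp
qed

lemma continuous_map_rot:
  assumes "\<And>i. continuous_map T euclideanreal (\<lambda>x. s x i)"
  shows "continuous_map T (matrix_topology (N + 2) (N + 2)) (\<lambda>x. rot N (s x))"
  unfolding rot_def
proof (intro continuous_map_mat_mult[where k = "N + 2"] continuous_map_householder_stereo assms)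
  show "continuous_map T (matrix_topology (N + 2) (N + 2)) (\<lambda>x. householder (unit_vec (N + 2) 1))"
    using householder_carrier[OF unit_vec_carrier] by (simp add: topspace_matrix_topology)
qed

lemma continuous_map_block_J:
  assumes "continuous_map T (matrix_topology N N) f"
  shows "continuous_map T (matrix_topology (N + 2) (N + 2)) (\<lambda>x. block_J (f x))"
  unfolding continuous_map_matrix_topology_iff
proof (intro conjI ballI allI impI)
  note f = assms[unfolded continuous_map_matrix_topology_iff]
  show "block_J (f x) \<in> carrier_mat (N + 2) (N + 2)" if "x \<in> topspace T" for x
    using f that by (intro block_J_carrier) auto
  fix i j assume ij: "i < N + 2" "j < N + 2"
  show "continuous_map T euclideanreal (\<lambda>x. block_J (f x) $$ (i, j))"
  proof (rule continuous_map_eq)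
    show "continuous_map T euclideanreal (\<lambda>x. if i < 2 \<and> j < 2 then J1 $$ (i, j)
        else if i < 2 \<or> j < 2 then 0 else f x $$ (i - 2, j - 2))"
      using f ij by (intro continuous_map_if) auto
    show "(if i < 2 \<and> j < 2 then J1 $$ (i, j) else if i < 2 \<or> j < 2 then 0 else f x $$ (i - 2, j - 2))
        = block_J (f x) $$ (i, j)" if "x \<in> topspace T" for x
      using f that by (intro block_J_index[OF _ ij, symmetric]) auto
  qed
qed

lemma continuous_map_lower_block:
  assumes "continuous_map T (matrix_topology (N + 2) (N + 2)) f"
  shows "continuous_map T (matrix_topology N N) (\<lambda>x. lower_block N (f x))"
  using assms unfolding continuous_map_matrix_topology_iff by (auto simp: lower_block_def)

text \<open>The first column is a unit vector, so its entry (1, 0) equals -1 only over the point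
  -e_1; exactly that fibre is removed.\<close>

lemma chart_homeomorphic_maps:
  "homeomorphic_maps (euclidean_times (2 * n + 2) (twistor_space n))
     (subtopology (twistor_space (Suc n)) {A. A $$ (1, 0) \<noteq> -1})
     (chart (2 * n + 2)) (chart_inv (2 * n + 2))"
  unfolding homeomorphic_maps_def
proof (intro conjI ballI)
  let ?N = "2 * n + 2"
  let ?E = "euclidean_times ?N (twistor_space n)"
  let ?U = "{A :: real mat. A $$ (1, 0) \<noteq> -1}"
  let ?Y = "subtopology (twistor_space (Suc n)) ?U"
  have dim: "2 * Suc n + 2 = ?N + 2" by simp
  have topE: "z \<in> topspace ?E \<longleftrightarrow> (\<forall>i\<ge>?N. fst z i = 0) \<and> snd z \<in> twistor_set n" for z
    by (cases z) (auto simp: topspace_Euclidean_space topspace_twistor_space)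
  have snd_c: "continuous_map ?E (matrix_topology ?N ?N) snd"
    using continuous_map_snd[of "Euclidean_space ?N" "twistor_space n"]
    unfolding continuous_map_twistor_space_iff by blast
  have rot_c: "continuous_map ?E (matrix_topology (?N + 2) (?N + 2)) (\<lambda>z. rot ?N (fst z))"
    by (intro continuous_map_rot continuous_map_euclidean_times_coordinate)
  have "continuous_map ?E (matrix_topology (?N + 2) (?N + 2)) (chart ?N)"
    unfolding chart_def
    by (intro continuous_map_mat_mult[where k = "?N + 2"] continuous_map_mat_transpose
        continuous_map_block_J rot_c snd_c)
  moreover have "chart ?N z \<in> twistor_set (Suc n)" "chart ?N z $$ (1, 0) \<noteq> -1" if z: "z \<in> topspace ?E" for z
  proof -
    have s: "snd z \<in> twistor_set n" using z topE by blast
    show "chart ?N z \<in> twistor_set (Suc n)" using chart_in_twistor_set[OF s, of "fst z"] by simp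
    show "chart ?N z $$ (1, 0) \<noteq> -1"
      using chart_entry_10[OF twistor_set_carrier[OF s], of "fst z"]
        stereo_vec_norm_pos[where N = ?N and s = "fst z"] by simp
  qed
  ultimately show "continuous_map ?E ?Y (chart ?N)"
    unfolding continuous_map_in_subtopology continuous_map_twistor_space_iff dim by auto
  have id_c: "continuous_map ?Y (matrix_topology (?N + 2) (?N + 2)) (\<lambda>A. A)"
    using continuous_map_from_twistor_space[of "Suc n" ?U] unfolding dim .
  have coord_c: "continuous_map ?Y euclideanreal (\<lambda>A. stereo_coord ?N A i)" for i
    unfolding stereo_coord_def
  proof (intro continuous_map_if continuous_map_real_divide continuous_map_add)
    show "1 + x $$ (1, 0) \<noteq> 0" if "x \<in> topspace ?Y" for x
      using that by auto
  qed (auto intro: continuous_map_twistor_entry)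
  have rot_c': "continuous_map ?Y (matrix_topology (?N + 2) (?N + 2)) (\<lambda>A. rot ?N (stereo_coord ?N A))"
    by (intro continuous_map_rot coord_c)
  have "continuous_map ?Y (matrix_topology ?N ?N) (snd \<circ> chart_inv ?N)"
    unfolding chart_inv_def o_def snd_conv
    by (intro continuous_map_lower_block continuous_map_mat_mult[where k = "?N + 2"]
        continuous_map_mat_transpose rot_c' id_c)
  moreover have Y: "A \<in> twistor_set (Suc n)" "A $$ (1, 0) \<noteq> -1" if "A \<in> topspace ?Y" for A
    using that by (auto simp: topspace_twistor_space)
  moreover have "snd (chart_inv ?N A) \<in> twistor_set n" if "A \<in> topspace ?Y" for A
    using chart_chart_inv(1) Y that by blast
  ultimately have 1: "continuous_map ?Y (twistor_space n) (snd \<circ> chart_inv ?N)"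
    unfolding continuous_map_twistor_space_iff by auto
  have 2: "continuous_map ?Y (Euclidean_space ?N) (fst \<circ> chart_inv ?N)"
    unfolding continuous_map_Euclidean_space_iff_components using coord_c
    by (auto simp: chart_inv_def stereo_coord_def)
  from 1 2 show "continuous_map ?Y ?E (chart_inv ?N)"
    by (simp add: continuous_map_pairwise)
  show "chart_inv ?N (chart ?N z) = z" if "z \<in> topspace ?E" for z
    using chart_inv_chart[of "snd z" ?N "fst z"] that twistor_set_carrier[of "snd z" n] topE[of z] by simp
  show "chart ?N (chart_inv ?N A) = A" if "A \<in> topspace ?Y" for A
    using chart_chart_inv(2) Y that by blast
qed

lemma image_Int_iff:
  assumes "\<And>z. z \<in> A \<Longrightarrow> z \<in> Z \<longleftrightarrow> f z \<in> V" "f ` A = B"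
  shows "f ` (A \<inter> Z) = B \<inter> V"
  using assms by blast

text \<open>The entry (1, 0) is 2 / (1 + |s|^2) - 1 and reaches 1 only for s = 0: the zero section
  corresponds to the fibre over e_1.\<close>

lemma chart_image_off_zero:
  "chart (2 * n + 2) ` (topspace (euclidean_times (2 * n + 2) (twistor_space n)) \<inter> off_zero (2 * n + 2))
    = topspace (subtopology (twistor_space (Suc n)) {A. A $$ (1, 0) \<noteq> -1}) \<inter> {A. A $$ (1, 0) \<noteq> 1}"
    (is "?c ` (topspace ?E \<inter> ?Z) = topspace ?Y \<inter> ?V")
proof -
  note h = chart_homeomorphic_maps[of n]
  have "z \<in> ?Z \<longleftrightarrow> ?c z \<in> ?V" if z: "z \<in> topspace ?E" for z
  proof -
    let ?N = "2 * n + 2"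
    obtain s B where zs: "z = (s, B)" by (cases z)
    have B: "B \<in> carrier_mat ?N ?N"
      using z by (intro twistor_set_carrier) (simp add: zs topspace_twistor_space)
    have iff: "2 / (1 + q) - 1 = (1 :: real) \<longleftrightarrow> q = 0" if "1 + q > 0" for q
      using that by (simp add: field_simps)
    have "?c z $$ (1, 0) = 2 / (1 + (\<Sum>i<?N. s i * s i)) - 1"
      unfolding zs by (rule chart_entry_10[OF B]) simp
    then have "?c z $$ (1, 0) = 1 \<longleftrightarrow> (\<Sum>i<?N. s i * s i) = 0"
      using iff[OF stereo_vec_norm_pos[where N = ?N and s = s]] by simp
    also have "\<dots> \<longleftrightarrow> (\<forall>i<?N. s i = 0)"
      by (subst sum_nonneg_eq_0_iff) auto
    finally show ?thesis by (auto simp: zs off_zero_def)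
  qed
  moreover have "?c ` topspace ?E = topspace ?Y"
    by (rule homeomorphic_imp_surjective_map[OF homeomorphic_maps_imp_map[OF h]])
  ultimately show ?thesis by (rule image_Int_iff)
qed

lemma relative_homology_chart:
  "relative_homology_group p (subtopology (twistor_space (Suc n)) {A. A $$ (1, 0) \<noteq> -1}) {A. A $$ (1, 0) \<noteq> 1}
    \<cong> homology_group (p - int (2 * n + 2)) (twistor_space n)"
proof -
  let ?E = "euclidean_times (2 * n + 2) (twistor_space n)"
  let ?Y = "subtopology (twistor_space (Suc n)) {A. A $$ (1, 0) \<noteq> -1}"
  have "homeomorphic_map ?E ?Y (chart (2 * n + 2))"
    by (rule homeomorphic_maps_imp_map[OF chart_homeomorphic_maps])
  from homeomorphic_map_relative_homology_iso[OF this Int_lower1 chart_image_off_zero]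
  have "relative_homology_group p ?E (off_zero (2 * n + 2)) \<cong> relative_homology_group p ?Y {A. A $$ (1, 0) \<noteq> 1}"
    unfolding relative_homology_group_restrict by (rule is_isoI)
  then show ?thesis
    by (rule iso_trans[OF group.iso_sym[OF group_relative_homology_group] relative_homology_off_zero])
qed

lemma homology_chart:
  "homology_group p (subtopology (twistor_space (Suc n)) {A. A $$ (1, 0) \<noteq> -1}) \<cong> homology_group p (twistor_space n)"
proof -
  let ?E = "euclidean_times (2 * n + 2) (twistor_space n)"
  let ?Y = "subtopology (twistor_space (Suc n)) {A. A $$ (1, 0) \<noteq> -1}"
  have "?E homeomorphic_space ?Y"
    unfolding homeomorphic_space_def by (intro exI, rule chart_homeomorphic_maps)
  then have "homology_group p ?E \<cong> homology_group p ?Y"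
    by (rule homeomorphic_space_imp_isomorphic_homology_groups)
  then have "homology_group p ?Y \<cong> homology_group p ?E"
    by (rule group.iso_sym[OF group_relative_homology_group])
  then show ?thesis by (rule iso_trans[OF _ homology_euclidean_times])
qed

section \<open>Exchange of the two poles, and excision\<close>

definition flip :: "nat \<Rightarrow> real mat" where
  "flip N = householder (unit_vec N 1) * householder (unit_vec N 2)"

text \<open>Reflecting e_1 alone would exchange the poles but also the two components; the second
  reflection, in e_2, restores determinant 1.\<close>

lemma flip_in_SO_mat: "2 < N \<Longrightarrow> flip N \<in> SO_mat N"
  unfolding flip_def by (intro householder_pair_in_SO_mat unit_vec_nonzero unit_vec_carrier) auto

lemma flip_mult_unit:
  assumes "2 < N"
  shows "flip N *\<^sub>v unit_vec N 0 = unit_vec N 0" "flip N *\<^sub>v unit_vec N 1 = - unit_vec N 1"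
proof -
  let ?e = "\<lambda>i. unit_vec N i :: real vec"
  have c: "householder (?e i) \<in> carrier_mat N N" for i by (intro householder_carrier unit_vec_carrier)
  have fx: "householder (?e i) *\<^sub>v ?e j = ?e j" if "i \<noteq> j" "i < N" "j < N" for i j
    using that by (intro householder_fix[of _ N]) auto
  have "householder (?e 1) *\<^sub>v ?e 1 = ?e 1 - 2 \<cdot>\<^sub>v ?e 1"
    using assms by (simp add: householder_mult_vec[of _ N])
  also have "\<dots> = - ?e 1" by (intro eq_vecI) auto
  finally have neg: "householder (?e 1) *\<^sub>v ?e 1 = - ?e 1" .
  show "flip N *\<^sub>v ?e 0 = ?e 0"
    unfolding flip_def assoc_mult_mat_vec[OF c c unit_vec_carrier]
    using assms fx[of 2 0] fx[of 1 0] by simp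
  show "flip N *\<^sub>v ?e 1 = - ?e 1"
    unfolding flip_def assoc_mult_mat_vec[OF c c unit_vec_carrier]
    using assms fx[of 2 1] neg by simp
qed

text \<open>The entry is the inner product of A e_0 with e_1; conjugation keeps e_0 and changes the
  sign of e_1.\<close>

lemma conj_entry_10:
  fixes A :: "real mat"
  assumes N: "2 < N" and A: "A \<in> carrier_mat N N" and R: "R \<in> SO_mat N"
    and e: "R *\<^sub>v unit_vec N 0 = unit_vec N 0" "R *\<^sub>v unit_vec N 1 = - unit_vec N 1"
  shows "(R * A * transpose_mat R) $$ (1, 0) = - A $$ (1, 0)"
proof -
  let ?e = "\<lambda>i. unit_vec N i :: real vec"
  have c: "R \<in> carrier_mat N N" using R by (rule SO_mat_carrier)
  have cc: "R * A * transpose_mat R \<in> carrier_mat N N"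
    using c A by (intro mult_carrier_mat[of _ N N]) auto
  have Ae: "A *\<^sub>v ?e 0 \<in> carrier_vec N" using A by simp
  have neg: "- ?e 1 \<in> carrier_vec N" by simp
  have "(R * A * transpose_mat R) $$ (1, 0) = (R * A * transpose_mat R *\<^sub>v ?e 0) $ 1"
    by (rule mult_mat_vec_unit[OF cc, symmetric]) (use N in auto)
  also have "\<dots> = (R *\<^sub>v (A *\<^sub>v ?e 0)) $ 1"
    unfolding conj_mult_unit[OF R A unit_vec_carrier e(1)] ..
  also have "\<dots> = (R *\<^sub>v (A *\<^sub>v ?e 0)) \<bullet> ?e 1"
    by (rule scalar_prod_right_unit[symmetric]) (use N in auto)
  also have "\<dots> = (A *\<^sub>v ?e 0) \<bullet> (transpose_mat R *\<^sub>v ?e 1)"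
    by (rule scalar_prod_mult_mat_vec[OF c Ae unit_vec_carrier])
  also have "transpose_mat R *\<^sub>v ?e 1 = - ?e 1"
  proof (rule transpose_fix_unit[OF R neg unit_vec_carrier])
    have "R *\<^sub>v (- ?e 1) = R *\<^sub>v ((-1) \<cdot>\<^sub>v ?e 1)"
      by (intro arg_cong[of _ _ "\<lambda>v. R *\<^sub>v v"] eq_vecI) auto
    also have "\<dots> = (-1) \<cdot>\<^sub>v (- ?e 1)"
      unfolding mult_mat_vec[OF c unit_vec_carrier] e(2) ..
    also have "\<dots> = ?e 1" by (intro eq_vecI) auto
    finally show "R *\<^sub>v (- ?e 1) = ?e 1" .
  qed
  also have "(A *\<^sub>v ?e 0) \<bullet> (- ?e 1) = - ((A *\<^sub>v ?e 0) \<bullet> ?e 1)"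
    using carrier_vecD[OF Ae] by (intro scalar_prod_uminus_right) simp
  also have "(A *\<^sub>v ?e 0) \<bullet> ?e 1 = (A *\<^sub>v ?e 0) $ 1"
    by (rule scalar_prod_right_unit) (use N in auto)
  also have "\<dots> = A $$ (1, 0)"
    by (rule mult_mat_vec_unit[OF A]) (use N in auto)
  finally show ?thesis .
qed

lemma flip_homeomorphic_maps:
  fixes n :: nat
  defines "K \<equiv> flip (2 * Suc n + 2)"
  shows "homeomorphic_maps (subtopology (twistor_space (Suc n)) {A. A $$ (1, 0) \<noteq> 1})
    (subtopology (twistor_space (Suc n)) {A. A $$ (1, 0) \<noteq> -1})
    (\<lambda>A. K * A * transpose_mat K) (\<lambda>A. transpose_mat K * A * K)"
    and "A \<in> twistor_set (Suc n) \<Longrightarrow> (K * A * transpose_mat K) $$ (1, 0) = - A $$ (1, 0)"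
proof -
  let ?N = "2 * Suc n + 2"
  let ?X = "twistor_space (Suc n)"
  have N: "2 < ?N" by simp
  have K: "K \<in> SO_mat ?N" unfolding K_def by (rule flip_in_SO_mat[OF N])
  have KT: "transpose_mat K \<in> SO_mat ?N" using K by (rule transpose_in_SO_mat)
  have cK: "K \<in> carrier_mat ?N ?N" "transpose_mat K \<in> carrier_mat ?N ?N"
    using K KT by (auto dest: SO_mat_carrier)
  have Ke: "K *\<^sub>v unit_vec ?N 0 = unit_vec ?N 0" "K *\<^sub>v unit_vec ?N 1 = - unit_vec ?N 1"
    unfolding K_def by (rule flip_mult_unit[OF N])+
  have KTe0: "transpose_mat K *\<^sub>v unit_vec ?N 0 = unit_vec ?N 0"
    by (rule transpose_fix_unit[OF K _ _ Ke(1)]) auto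
  have "transpose_mat K *\<^sub>v (- unit_vec ?N 1) = unit_vec ?N 1"
    by (rule transpose_fix_unit[OF K _ _ Ke(2)]) auto
  moreover have "transpose_mat K *\<^sub>v (- unit_vec ?N 1) = transpose_mat K *\<^sub>v ((-1) \<cdot>\<^sub>v unit_vec ?N 1)"
    by (intro arg_cong[of _ _ "\<lambda>v. transpose_mat K *\<^sub>v v"] eq_vecI) auto
  ultimately have "(-1) \<cdot>\<^sub>v (transpose_mat K *\<^sub>v unit_vec ?N 1) = unit_vec ?N 1"
    unfolding mult_mat_vec[OF cK(2) unit_vec_carrier] by simp
  then have "(-1) \<cdot>\<^sub>v ((-1) \<cdot>\<^sub>v (transpose_mat K *\<^sub>v unit_vec ?N 1)) = (-1) \<cdot>\<^sub>v unit_vec ?N 1"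
    by (rule arg_cong)
  moreover have "(-1) \<cdot>\<^sub>v ((-1) \<cdot>\<^sub>v (transpose_mat K *\<^sub>v unit_vec ?N 1)) = transpose_mat K *\<^sub>v unit_vec ?N 1"
    by (intro eq_vecI) auto
  moreover have "(-1) \<cdot>\<^sub>v unit_vec ?N 1 = (- unit_vec ?N 1 :: real vec)"
    by (intro eq_vecI) auto
  ultimately have KTe1: "transpose_mat K *\<^sub>v unit_vec ?N 1 = - unit_vec ?N 1" by simp
  have f10: "(K * A * transpose_mat K) $$ (1, 0) = - A $$ (1, 0)" if "A \<in> twistor_set (Suc n)" for A
    by (rule conj_entry_10[OF N twistor_set_carrier[OF that] K Ke])
  have g10: "(transpose_mat K * A * K) $$ (1, 0) = - A $$ (1, 0)" if "A \<in> twistor_set (Suc n)" for A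
    using conj_entry_10[OF N twistor_set_carrier[OF that] KT KTe0 KTe1] by (simp only: transpose_transpose)
  show "A \<in> twistor_set (Suc n) \<Longrightarrow> (K * A * transpose_mat K) $$ (1, 0) = - A $$ (1, 0)" by (rule f10)
  have fX: "K * A * transpose_mat K \<in> twistor_set (Suc n)" if "A \<in> twistor_set (Suc n)" for A
    by (rule twistor_set_conj[OF K that])
  have gX: "transpose_mat K * A * K \<in> twistor_set (Suc n)" if "A \<in> twistor_set (Suc n)" for A
    using twistor_set_conj[OF KT that] by (simp only: transpose_transpose)
  have cc: "continuous_map T (matrix_topology ?N ?N) (\<lambda>_. K)"
      "continuous_map T (matrix_topology ?N ?N) (\<lambda>_. transpose_mat K)" for T :: "real mat topology"
    using cK by (simp_all add: topspace_matrix_topology)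
  have top: "A \<in> topspace (subtopology ?X U) \<longleftrightarrow> A \<in> twistor_set (Suc n) \<and> A \<in> U" for A U
    by (simp add: topspace_twistor_space)
  show "homeomorphic_maps (subtopology ?X {A. A $$ (1, 0) \<noteq> 1}) (subtopology ?X {A. A $$ (1, 0) \<noteq> -1})
    (\<lambda>A. K * A * transpose_mat K) (\<lambda>A. transpose_mat K * A * K)"
    unfolding homeomorphic_maps_def
  proof (intro conjI ballI)
    show "continuous_map (subtopology ?X {A. A $$ (1, 0) \<noteq> 1}) (subtopology ?X {A. A $$ (1, 0) \<noteq> -1})
      (\<lambda>A. K * A * transpose_mat K)"
      unfolding continuous_map_in_subtopology continuous_map_twistor_space_iff
    proof (intro conjI)
      show "continuous_map (subtopology ?X {A. A $$ (1, 0) \<noteq> 1}) (matrix_topology ?N ?N) (\<lambda>A. K * A * transpose_mat K)"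
        by (intro continuous_map_mat_mult[where k = ?N] cc continuous_map_from_twistor_space)
    qed (use f10 fX in \<open>auto simp: topspace_twistor_space\<close>)
    show "continuous_map (subtopology ?X {A. A $$ (1, 0) \<noteq> -1}) (subtopology ?X {A. A $$ (1, 0) \<noteq> 1})
      (\<lambda>A. transpose_mat K * A * K)"
      unfolding continuous_map_in_subtopology continuous_map_twistor_space_iff
    proof (intro conjI)
      show "continuous_map (subtopology ?X {A. A $$ (1, 0) \<noteq> -1}) (matrix_topology ?N ?N) (\<lambda>A. transpose_mat K * A * K)"
        by (intro continuous_map_mat_mult[where k = ?N] cc continuous_map_from_twistor_space)
    qed (use g10 gX in \<open>auto simp: topspace_twistor_space\<close>)
    show "transpose_mat K * (K * A * transpose_mat K) * K = A" if "A \<in> topspace (subtopology ?X U)" for A U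
    proof -
      have cA: "A \<in> carrier_mat ?N ?N" using that top twistor_set_carrier by blast
      have "transpose_mat K * (K * A * transpose_mat K) * K = (transpose_mat K * K) * (A * (transpose_mat K * K))"
        using cA cK by (simp add: assoc_mult_mat[of _ ?N ?N _ ?N _ ?N])
      then show ?thesis using cA unfolding SO_mat_transpose_mult[OF K] by simp
    qed
    show "K * (transpose_mat K * A * K) * transpose_mat K = A" if "A \<in> topspace (subtopology ?X U)" for A U
    proof -
      have cA: "A \<in> carrier_mat ?N ?N" using that top twistor_set_carrier by blast
      have "K * (transpose_mat K * A * K) * transpose_mat K = (K * transpose_mat K) * (A * (K * transpose_mat K))"
        using cA cK by (simp add: assoc_mult_mat[of _ ?N ?N _ ?N _ ?N])
      then show ?thesis using cA unfolding SO_mat_mult_transpose[OF K] by simp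
    qed
  qed
qed

lemma relative_homology_flip:
  "relative_homology_group p (subtopology (twistor_space (Suc n)) {A. A $$ (1, 0) \<noteq> 1}) {A. A $$ (1, 0) \<noteq> -1}
   \<cong> relative_homology_group p (subtopology (twistor_space (Suc n)) {A. A $$ (1, 0) \<noteq> -1}) {A. A $$ (1, 0) \<noteq> 1}"
proof -
  let ?V = "{A :: real mat. A $$ (1, 0) \<noteq> 1}" and ?U = "{A :: real mat. A $$ (1, 0) \<noteq> -1}"
  let ?XV = "subtopology (twistor_space (Suc n)) ?V"
  let ?XU = "subtopology (twistor_space (Suc n)) ?U"
  define f where "f = (\<lambda>A. flip (2 * Suc n + 2) * A * transpose_mat (flip (2 * Suc n + 2)))"
  have h: "homeomorphic_map ?XV ?XU f"
    unfolding f_def by (rule homeomorphic_maps_imp_map[OF flip_homeomorphic_maps(1)])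
  have f10: "f A $$ (1, 0) = - A $$ (1, 0)" if "A \<in> topspace ?XV" for A
    using flip_homeomorphic_maps(2)[of A n] that unfolding f_def by (simp add: topspace_twistor_space)
  have "A \<in> ?U \<longleftrightarrow> f A \<in> ?V" if "A \<in> topspace ?XV" for A
    using f10[OF that] by auto
  then have im: "f ` (topspace ?XV \<inter> ?U) = topspace ?XU \<inter> ?V"
    using homeomorphic_imp_surjective_map[OF h] by (rule image_Int_iff)
  from homeomorphic_map_relative_homology_iso[OF h Int_lower1 im]
  show ?thesis unfolding relative_homology_group_restrict by (rule is_isoI)
qed

text \<open>What is excised is the fibre over e_1, which is closed and lies in the open part over
  the complement of -e_1. The rest lies over the complement of e_1, while the chart covers that of
  -e_1; \<open>relative_homology_flip\<close> repairs the mismatch.\<close>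

lemma relative_homology_twistor:
  "relative_homology_group p (twistor_space (Suc n)) {A. A $$ (1, 0) \<noteq> -1}
   \<cong> homology_group (p - int (2 * n + 2)) (twistor_space n)"
proof -
  let ?X = "twistor_space (Suc n)"
  let ?V = "{A :: real mat. A $$ (1, 0) \<noteq> 1}" and ?U = "{A :: real mat. A $$ (1, 0) \<noteq> -1}"
  have c: "continuous_map ?X euclideanreal (\<lambda>A. A $$ (1, 0))"
    using continuous_map_twistor_entry[of 1 "Suc n" 0 UNIV] by simp
  have "openin ?X {A \<in> topspace ?X. A $$ (1, 0) \<in> - {-1}}"
    by (rule openin_continuous_map_preimage[OF c]) auto
  then have oU: "openin ?X (topspace ?X \<inter> ?U)" by (simp add: Int_def)
  have "closedin ?X {A \<in> topspace ?X. A $$ (1, 0) \<in> {1}}"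
    by (rule closedin_continuous_map_preimage[OF c]) auto
  then have cZ: "closedin ?X (topspace ?X \<inter> - ?V)" by (simp add: Int_def)
  have "?X closure_of (- ?V) = ?X closure_of (topspace ?X \<inter> - ?V)" by (rule closure_of_restrict)
  also have "\<dots> = topspace ?X \<inter> - ?V" using cZ by (rule closure_of_closedin)
  also have "\<dots> \<subseteq> topspace ?X \<inter> ?U" by auto
  also have "\<dots> \<subseteq> ?X interior_of (topspace ?X \<inter> ?U)"
    by (rule interior_of_maximal[OF order_refl oU])
  also have "\<dots> = ?X interior_of ?U" by (rule interior_of_restrict[symmetric])
  finally have ex: "?X closure_of (- ?V) \<subseteq> ?X interior_of ?U" .
  have "UNIV - - ?V = ?V" "?U - - ?V = ?V \<inter> ?U" by auto
  then have "relative_homology_group p (subtopology ?X ?V) (?V \<inter> ?U) \<cong> relative_homology_group p ?X ?U"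
    using homology_excision_axiom[OF ex subset_UNIV, of p] by (intro is_isoI) simp
  moreover have "relative_homology_group p (subtopology ?X ?V) (?V \<inter> ?U) = relative_homology_group p (subtopology ?X ?V) ?U"
  proof -
    have "topspace (subtopology ?X ?V) \<inter> (?V \<inter> ?U) = topspace (subtopology ?X ?V) \<inter> ?U" by auto
    then show ?thesis by (metis relative_homology_group_restrict)
  qed
  ultimately have 1: "relative_homology_group p (subtopology ?X ?V) ?U \<cong> relative_homology_group p ?X ?U" by simp
  show ?thesis
    by (rule iso_trans[OF group.iso_sym[OF group_relative_homology_group 1]
          iso_trans[OF relative_homology_flip relative_homology_chart]])
qed

section \<open>Betti numbers\<close>

text \<open>In the exact sequence of the pair the group stands between two trivial ones.\<close>

lemma trivial_homology_of_pair:
  assumes "trivial_group (homology_group p (subtopology X S))" "trivial_group (relative_homology_group p X S)"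
  shows "trivial_group (homology_group p X)"
proof -
  let ?i = "hom_induced p (subtopology X S) {} X {} id" and ?j = "hom_induced p X {} X S id"
  let ?A = "homology_group p (subtopology X S)" and ?B = "homology_group p X" and ?C = "relative_homology_group p X S"
  have "carrier ?B = kernel ?B ?C ?j"
    using hom_in_carrier[OF hom_induced_hom, of _ p X "{}" X S id] assms(2)
    by (auto simp: kernel_def trivial_group_def)
  also have "\<dots> = ?i ` carrier ?A"
    using homology_exactness_axiom_3[of p X S] by simp
  also have "\<dots> = {\<one>\<^bsub>?B\<^esub>}"
    using assms(1) hom_one[OF hom_induced_hom, of p "subtopology X S" "{}" X "{}" id]
    by (simp add: trivial_group_def)
  finally show ?thesis by (simp add: trivial_group_def)
qed

text \<open>The hypotheses kill the connecting maps into and out of degree p, which leaves a short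
  exact sequence.\<close>

lemma homology_rank_of_pair:
  assumes "trivial_group (homology_group (p - 1) (subtopology X S))"
    "trivial_group (relative_homology_group (p + 1) X S)"
  shows "abelian_group_rank (homology_group p X)
    = abelian_group_rank (homology_group p (subtopology X S)) + abelian_group_rank (relative_homology_group p X S)"
proof -
  let ?i = "hom_induced p (subtopology X S) {} X {} id" and ?j = "hom_induced p X {} X S id"
  let ?A = "homology_group p (subtopology X S)" and ?B = "homology_group p X" and ?C = "relative_homology_group p X S"
  let ?d = "hom_boundary p X S" and ?e = "hom_boundary (p + 1) X S"
  have ex: "?i ` carrier ?A = kernel ?B ?C ?j"
    using homology_exactness_axiom_3[of p X S] by simp
  have i: "?i \<in> hom ?A ?B" and j: "?j \<in> hom ?B ?C" by (rule hom_induced_hom)+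
  have e: "?e \<in> hom (relative_homology_group (p + 1) X S) ?A"
    using hom_boundary_hom[of "p + 1" X S] by simp
  interpret i: group_hom ?A ?B ?i
    by (simp add: group_hom_def group_hom_axioms_def i)
  have "kernel ?A ?B ?i = ?e ` carrier (relative_homology_group (p + 1) X S)"
    using homology_exactness_axiom_2[of "p + 1" X S] by simp
  also have "\<dots> = {\<one>\<^bsub>?A\<^esub>}"
    using assms(2) hom_one[OF e] by (simp add: trivial_group_def)
  finally have inj: "inj_on ?i (carrier ?A)" by (simp add: i.inj_iff_trivial_ker)
  have "?j ` carrier ?B = kernel ?C (homology_group (p - 1) (subtopology X S)) ?d"
    using homology_exactness_axiom_1[of p X S] by simp
  also have "\<dots> = carrier ?C"
    using assms(1) hom_boundary_carrier[of p X S] by (auto simp: kernel_def trivial_group_def)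
  finally have surj: "?j ` carrier ?B = carrier ?C" .
  have comm: "comm_group ?A" "comm_group ?B" "comm_group ?C" by simp_all
  show ?thesis
    using abelian_group_rank_exact_le[OF comm i j ex] abelian_group_rank_exact_ge[OF comm i inj j surj ex]
    by (rule antisym)
qed

text \<open>The open part and the pair have the homology of the smaller space in degrees p and p -
  (2n + 2), which have the same parity. A point has homology only in degree 0, which is
  even.\<close>

lemma twistor_homology_odd:
  "odd p \<Longrightarrow> trivial_group (homology_group p (twistor_space n))"
proof (induction n arbitrary: p)
  case 0
  have "topspace (twistor_space 0) = {J0 0}" by (simp add: topspace_twistor_space twistor_set_0)
  moreover have "p \<noteq> 0" using 0 by auto
  ultimately show ?case by (rule homology_dimension_axiom)
next
  case (Suc n)
  have "odd (p - int (2 * n + 2))" using Suc.prems by simp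
  then have "trivial_group (relative_homology_group p (twistor_space (Suc n)) {A. A $$ (1, 0) \<noteq> -1})"
    unfolding isomorphic_group_triviality[OF relative_homology_twistor group_relative_homology_group group_relative_homology_group]
    by (rule Suc.IH)
  moreover have "trivial_group (homology_group p (subtopology (twistor_space (Suc n)) {A. A $$ (1, 0) \<noteq> -1}))"
    unfolding isomorphic_group_triviality[OF homology_chart group_relative_homology_group group_relative_homology_group]
    by (rule Suc.IH[OF Suc.prems])
  ultimately show ?case by (rule trivial_homology_of_pair[rotated])
qed

text \<open>In odd degree all three ranks are 0. For even p the neighbours p - 1 and p + 1 are odd,
  which supplies the vanishing that \<open>homology_rank_of_pair\<close> asks for.\<close>

lemma twistor_homology_rank_Suc:
  "abelian_group_rank (homology_group p (twistor_space (Suc n)))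
   = abelian_group_rank (homology_group p (twistor_space n))
     + abelian_group_rank (homology_group (p - int (2 * n + 2)) (twistor_space n))"
proof (cases "odd p")
  case True
  then have "odd (p - int (2 * n + 2))" by simp
  then show ?thesis
    using True by (subst (1 2 3) abelian_group_rank_trivial) (auto intro!: twistor_homology_odd)
next
  case False
  let ?U = "{A :: real mat. A $$ (1, 0) \<noteq> -1}"
  have "trivial_group (homology_group (p - 1) (subtopology (twistor_space (Suc n)) ?U))"
    unfolding isomorphic_group_triviality[OF homology_chart group_relative_homology_group group_relative_homology_group]
    by (rule twistor_homology_odd) (use False in simp)
  moreover have "trivial_group (relative_homology_group (p + 1) (twistor_space (Suc n)) ?U)"
    unfolding isomorphic_group_triviality[OF relative_homology_twistor group_relative_homology_group group_relative_homology_group]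
    by (rule twistor_homology_odd) (use False in simp)
  ultimately have "abelian_group_rank (homology_group p (twistor_space (Suc n)))
    = abelian_group_rank (homology_group p (subtopology (twistor_space (Suc n)) ?U))
      + abelian_group_rank (relative_homology_group p (twistor_space (Suc n)) ?U)"
    by (rule homology_rank_of_pair)
  then show ?thesis
    unfolding abelian_group_rank_iso[OF abelian_relative_homology_group abelian_relative_homology_group homology_chart]
      abelian_group_rank_iso[OF abelian_relative_homology_group abelian_relative_homology_group relative_homology_twistor] .
qed

text \<open>Subtraction of naturals stops at 0, so degrees below the shift are separated; there the
  integer degree is negative and the group is trivial.\<close>

lemma betti_number_twistor_Suc:
  "betti_number i (twistor_space (Suc n))
    = betti_number i (twistor_space n) + (if i < 2 * n + 2 then 0 else betti_number (i - (2 * n + 2)) (twistor_space n))"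
proof (cases "i < 2 * n + 2")
  case True
  then have "trivial_group (homology_group (int i - int (2 * n + 2)) (twistor_space n))"
    by (intro trivial_homology_group) simp
  then show ?thesis
    using True by (simp add: betti_number_def twistor_homology_rank_Suc abelian_group_rank_trivial)
next
  case False
  then have "int i - int (2 * n + 2) = int (i - (2 * n + 2))" by simp
  then show ?thesis
    using False by (simp only: betti_number_def twistor_homology_rank_Suc if_False)
qed

lemma betti_number_twistor_0: "betti_number i (twistor_space 0) = (if i = 0 then 1 else 0)"
proof -
  have X: "topspace (twistor_space 0) = {J0 0}" by (simp add: topspace_twistor_space twistor_set_0)
  show ?thesis
  proof (cases "i = 0")
    case True
    have "abelian_group_rank (homology_group 0 (twistor_space 0)) = abelian_group_rank integer_group"
      by (rule abelian_group_rank_iso[OF abelian_homology_group abelian_integer_group homology_coefficients[OF X]])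
    then show ?thesis using True by (simp add: betti_number_def abelian_group_rank_integer_group)
  next
    case False
    then have "trivial_group (homology_group (int i) (twistor_space 0))"
      by (intro homology_dimension_axiom[OF X]) simp
    then show ?thesis using False by (simp add: betti_number_def abelian_group_rank_trivial)
  qed
qed

text \<open>Multiplication by a power of \<open>fps_X\<close> shifts coefficients and puts zeros
  below the exponent, which matches the recursion of the Betti numbers. Distributivity suffices, so
  a semiring of coefficients such as \<open>enat\<close> is enough.\<close>

lemma poincare_polynomial_twistor_Suc:
  "poincare_polynomial (twistor_space (Suc n)) = poincare_polynomial (twistor_space n) * (1 + fps_X ^ (2 * Suc n))"
proof -
  have "2 * Suc n = 2 * n + 2" by simp
  then show ?thesis
    by (intro fps_ext) (simp only: poincare_polynomial_def fps_nth_Abs_fps betti_number_twistor_Suc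
        distrib_left mult_1_right fps_add_nth fps_X_power_mult_right_nth)
qed

lemma poincare_polynomial_twistor:
  "poincare_polynomial (twistor_space n) = (\<Prod>k = 1..n. 1 + fps_X ^ (2 * k))"
proof (induction n)
  case 0
  show ?case
    by (rule fps_ext) (simp add: poincare_polynomial_def betti_number_twistor_0)
next
  case (Suc n)
  then show ?case by (simp add: poincare_polynomial_twistor_Suc)
qed

theorem theorem2p7:
  fixes n :: nat
  assumes "n \<ge> 1"
  shows "poincare_polynomial (twistor_space n) = (\<Prod>k = 1..n. 1 + fps_X ^ (2 * k))"
  by (rule poincare_polynomial_twistor)

end
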